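(* Let $N\ge2$, $\alpha\in\mathbb{C}^N$, and suppose there is $k\in\{1,\ldots,N\}$ with $\operatorname{Im}\alpha_k\neq0$. Let $A=(a_{ij})$ be the real $2\times(N-1)$ matrix whose columns are indexed by $j\in\{1,\ldots,N\}\setminus\{k\}$ (in increasing order) with $$a_{1j}=\operatorname{Re}\alpha_j\operatorname{Im}\alpha_k-\operatorname{Re}\alpha_k\operatorname{Im}\alpha_j,\qquad a_{2j}=\operatorname{Im}\alpha_j.$$ Then $\mathcal{M}_N$ is a dense $\mathcal{G}_\delta$ subset of $\mathbb{C}$ if and only if $$\{r\in\mathbb{Q}^2:\ (\operatorname{Im}\alpha_k)^{-1}A^{T}r\in\mathbb{Q}^{N-1}\}=\{(0,0)\}.$$
   Context: $\mathbb{T}^n=\mathbb{R}^n/2\pi\mathbb{Z}^n$; $D_t=-i\partial_t$, $D_{x_j}=-i\partial_{x_j}$. A linear differential operator $P$ on $\mathbb{T}^n$ is globally hypoelliptic (GH) if $u\in\mathcal{D}'(\mathbb{T}^n)$ and $Pu\in\mathcal{C}^\infty(\mathbb{T}^n)$ imply $u\in\mathcal{C}^\infty(\mathbb{T}^n)$. For $\alpha\in\mathbb{C}^N$, $L_N=D_t+\sum_{j=1}^N\alpha_jD_{x_j}$ on $\mathbb{T}^{N+1}$, $P_{N,\lambda}=L_N-\lambda$ ($\lambda\in\mathbb{C}$), and $\mathcal{M}_N=\{\lambda\in\mathbb{C}: P_{N,\lambda}\text{ is not GH}\}$. *)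

theory Defs
  imports "HOL-Analysis.Analysis"
begin

text \<open>The torus T^{N+1} is modelled by 2pi-periodic functions on the euclidean
space real \<times> (real^'n), the first coordinate being t and the second x = (x_1..x_N),
with CARD('n) = N.\<close>

type_synonym 'n pt = "real \<times> (real ^ 'n)"

definition pd :: "'a::euclidean_space \<Rightarrow> ('a \<Rightarrow> complex) \<Rightarrow> ('a \<Rightarrow> complex)" where
  "pd b f = (\<lambda>z. frechet_derivative f (at z) b)"

fun Ck :: "nat \<Rightarrow> ('a::euclidean_space \<Rightarrow> complex) \<Rightarrow> bool" where
  "Ck 0 f = continuous_on UNIV f"
| "Ck (Suc k) f = ((\<forall>z. f differentiable (at z)) \<and> (\<forall>b\<in>Basis. Ck k (pd b f)))"

definition smooth_fun :: "('a::euclidean_space \<Rightarrow> complex) \<Rightarrow> bool" where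
  "smooth_fun f = (\<forall>k. Ck k f)"

definition periodic_fun :: "('a::euclidean_space \<Rightarrow> complex) \<Rightarrow> bool" where
  "periodic_fun f = (\<forall>z. \<forall>b\<in>Basis. f (z + (2*pi) *\<^sub>R b) = f z)"

definition Cinf_torus :: "('a::euclidean_space \<Rightarrow> complex) set" where
  "Cinf_torus = {f. smooth_fun f \<and> periodic_fun f}"

fun dlist :: "'a::euclidean_space list \<Rightarrow> ('a \<Rightarrow> complex) \<Rightarrow> ('a \<Rightarrow> complex)" where
  "dlist [] f = f"
| "dlist (b # bs) f = pd b (dlist bs f)"

text \<open>Distributions on the torus: linear functionals on C^\<infinity>(T^n) continuous for
the Frechet topology given by the seminorms sup |\<partial>^\<beta> \<phi>|, |\<beta>| \<le> k.\<close>
definition distribution :: "(('a::euclidean_space \<Rightarrow> complex) \<Rightarrow> complex) \<Rightarrow> bool" where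
  "distribution u =
     ((\<forall>\<phi>\<in>Cinf_torus. \<forall>\<psi>\<in>Cinf_torus. u (\<lambda>z. \<phi> z + \<psi> z) = u \<phi> + u \<psi>) \<and>
      (\<forall>\<phi>\<in>Cinf_torus. \<forall>c. u (\<lambda>z. c * \<phi> z) = c * u \<phi>) \<and>
      (\<exists>C k. \<forall>\<phi>\<in>Cinf_torus.
          (\<forall>bs z. set bs \<subseteq> Basis \<and> length bs \<le> k \<longrightarrow> norm (dlist bs \<phi> z) \<le> 1)
          \<longrightarrow> norm (u \<phi>) \<le> C))"

definition fun_distr :: "('a::euclidean_space \<Rightarrow> complex) \<Rightarrow> ('a \<Rightarrow> complex) \<Rightarrow> complex" where
  "fun_distr f \<phi> = integral (cbox 0 ((2*pi) *\<^sub>R One)) (\<lambda>z. f z * \<phi> z)"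

definition smooth_distr :: "(('a::euclidean_space \<Rightarrow> complex) \<Rightarrow> complex) \<Rightarrow> bool" where
  "smooth_distr u = (\<exists>f\<in>Cinf_torus. \<forall>\<phi>\<in>Cinf_torus. u \<phi> = fun_distr f \<phi>)"

definition Dt :: "('n::finite pt \<Rightarrow> complex) \<Rightarrow> ('n pt \<Rightarrow> complex)" where
  "Dt f = (\<lambda>z. - \<i> * pd (1, 0) f z)"

definition Dx :: "'n::finite \<Rightarrow> ('n pt \<Rightarrow> complex) \<Rightarrow> ('n pt \<Rightarrow> complex)" where
  "Dx j f = (\<lambda>z. - \<i> * pd (0, axis j 1) f z)"

text \<open>Formal transpose of P = D_t + \<Sum> \<alpha>_j D_{x_j} - \<lambda>.\<close>
definition P_transpose :: "complex ^ 'n::finite \<Rightarrow> complex \<Rightarrow> ('n pt \<Rightarrow> complex) \<Rightarrow> ('n pt \<Rightarrow> complex)" where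
  "P_transpose \<alpha> lam \<phi> = (\<lambda>z. - Dt \<phi> z - (\<Sum>j\<in>UNIV. \<alpha> $ j * Dx j \<phi> z) - lam * \<phi> z)"

definition P_op :: "complex ^ 'n::finite \<Rightarrow> complex \<Rightarrow> (('n pt \<Rightarrow> complex) \<Rightarrow> complex) \<Rightarrow> (('n pt \<Rightarrow> complex) \<Rightarrow> complex)" where
  "P_op \<alpha> lam u = (\<lambda>\<phi>. u (P_transpose \<alpha> lam \<phi>))"

definition globally_hypoelliptic :: "complex ^ 'n::finite \<Rightarrow> complex \<Rightarrow> bool" where
  "globally_hypoelliptic \<alpha> lam =
     (\<forall>u. distribution u \<longrightarrow> smooth_distr (P_op \<alpha> lam u) \<longrightarrow> smooth_distr u)"

definition M_set :: "complex ^ 'n::finite \<Rightarrow> complex set" where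
  "M_set \<alpha> = {lam. \<not> globally_hypoelliptic \<alpha> lam}"

definition a1 :: "complex ^ 'n::finite \<Rightarrow> 'n \<Rightarrow> 'n \<Rightarrow> real" where
  "a1 \<alpha> k j = Re (\<alpha> $ j) * Im (\<alpha> $ k) - Re (\<alpha> $ k) * Im (\<alpha> $ j)"

definition a2 :: "complex ^ 'n::finite \<Rightarrow> 'n \<Rightarrow> 'n \<Rightarrow> real" where
  "a2 \<alpha> k j = Im (\<alpha> $ j)"

end

(* On the lattice of frequencies zeta the operator acts by symb zeta - lam, so by Fourier series it fails
   to be globally hypoelliptic iff, for every m, infinitely many zeta satisfy
   |symb zeta - lam| < (1 + |zeta|)^(-m). Hence M_set is always a countable intersection of open sets,
   each a union of balls centred at all but finitely many points of the group G = symb(lattice), and by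
   Baire it is dense iff G is. If G is not dense, the distance to G, read in the real basis 1, alpha_k, is
   a nonconstant continuous function on the two-torus that is invariant under translation by the alpha_j;
   a nonvanishing Fourier mode of it is an integer functional taking integer values on G. *)
theory Submission
  imports Defs
begin

section \<open>Lattice frequencies and characters\<close>

text \<open>The Fourier theory is developed over an arbitrary Euclidean space because two tori
  occur: one of dimension N + 1 carries the operator, one of dimension 2 carries the density
  argument. Distributions are given only as functionals with a seminorm bound, so much of the work
  lies in showing that their values on characters determine them and that rapid decay of these
  values means smoothness.

  Since \<open>Im (\<alpha> $ k)\<close> is nonzero, every \<open>\<alpha> $ j\<close> has real
  coordinates \<open>x j\<close>, \<open>y j\<close> with respect to 1 and
  \<open>\<alpha> $ k\<close>. The matrix A is \<open>Im (\<alpha> $ k)\<close> times the table of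
  these coordinates, so the condition of the theorem concerns rational functionals taking rational
  values on the group; clearing denominators makes them integral.

  Working with the distance function instead of a classification of the closed subgroups of the
  plane lets the density criterion rest on the same uniqueness of Fourier coefficients that
  hypoellipticity requires.\<close>

definition lat :: "'a::euclidean_space set" where
  "lat = {\<zeta>. \<forall>b\<in>Basis. \<zeta> \<bullet> b \<in> \<int>}"

abbreviation cube :: "'a::euclidean_space set" where
  "cube \<equiv> cbox 0 ((2*pi) *\<^sub>R One)"

definition tchar :: "'a::euclidean_space \<Rightarrow> 'a \<Rightarrow> complex" where
  "tchar \<zeta> z = cis (\<zeta> \<bullet> z)"

text \<open>Left unnormalised, the coefficient is literally the pairing of \<open>f\<close> with the
  character of \<open>-\<zeta>\<close>. The factor \<open>(2*pi) ^ DIM('a)\<close> reappears in the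
  inversion formula.\<close>

definition fcoef :: "('a::euclidean_space \<Rightarrow> complex) \<Rightarrow> 'a \<Rightarrow> complex" where
  "fcoef f \<zeta> = integral cube (\<lambda>z. f z * tchar (-\<zeta>) z)"

definition fseries :: "('a::euclidean_space \<Rightarrow> complex) \<Rightarrow> 'a \<Rightarrow> complex" where
  "fseries a z = (\<Sum>\<^sub>\<infinity>\<zeta>\<in>lat. a \<zeta> * tchar \<zeta> z)"

text \<open>The weight \<open>1 + norm \<zeta>\<close> avoids an exception at frequency 0 and makes
  its powers increasing in \<open>m\<close>. Values off the lattice are left free.\<close>

definition rapid :: "('a::euclidean_space \<Rightarrow> complex) \<Rightarrow> bool" where
  "rapid a \<longleftrightarrow> (\<forall>m. \<exists>C. \<forall>\<zeta>\<in>lat. norm (a \<zeta>) * (1 + norm \<zeta>) ^ m \<le> C)"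

lemma lat_zero: "0 \<in> lat" and lat_uminus: "\<zeta> \<in> lat \<Longrightarrow> - \<zeta> \<in> lat"
  and lat_add: "\<zeta> \<in> lat \<Longrightarrow> \<eta> \<in> lat \<Longrightarrow> \<zeta> + \<eta> \<in> lat"
  and lat_Basis: "b \<in> Basis \<Longrightarrow> b \<in> lat"
  by (auto simp: lat_def inner_add_left inner_Basis)

lemma lat_uminus_iff [simp]: "- \<zeta> \<in> lat \<longleftrightarrow> \<zeta> \<in> lat"
  using lat_uminus[of \<zeta>] lat_uminus[of "-\<zeta>"] by auto

lemma bij_betw_uminus_lat: "bij_betw uminus lat (lat :: 'a::euclidean_space set)"
  by (rule bij_betwI[where g = uminus]) auto

lemma tchar_0 [simp]: "tchar 0 z = 1" "tchar \<zeta> 0 = 1"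
  by (simp_all add: tchar_def)

lemma tchar_add_left: "tchar (\<zeta> + \<eta>) z = tchar \<zeta> z * tchar \<eta> z"
  by (simp add: tchar_def inner_add_left cis_mult)

lemma tchar_add_right: "tchar \<zeta> (z + w) = tchar \<zeta> z * tchar \<zeta> w"
  by (simp add: tchar_def inner_add_right cis_mult)

lemma norm_tchar [simp]: "norm (tchar \<zeta> z) = 1"
  by (simp add: tchar_def)

lemma tchar_has_derivative:
  "(tchar \<zeta> has_derivative (\<lambda>h. \<i> * of_real (\<zeta> \<bullet> h) * tchar \<zeta> z)) (at z)"
proof -
  have "((\<lambda>z. exp (\<i> * of_real (\<zeta> \<bullet> z))) has_derivative
      (\<lambda>h. exp (\<i> * of_real (\<zeta> \<bullet> z)) * (\<i> * of_real (\<zeta> \<bullet> h)))) (at z)"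
  proof -
    have "((\<lambda>z. \<i> * complex_of_real (\<zeta> \<bullet> z)) has_derivative (\<lambda>h. \<i> * of_real (\<zeta> \<bullet> h))) (at z)"
      by (intro bounded_linear_imp_has_derivative bounded_linear_const_mult
            bounded_linear_compose[OF bounded_linear_of_real] bounded_linear_inner_right)
    from diff_chain_at[OF this DERIV_exp[unfolded has_field_derivative_def]]
    show ?thesis by (simp add: o_def)
  qed
  then show ?thesis
    by (simp add: tchar_def[abs_def] cis_conv_exp mult.commute mult.left_commute)
qed

lemma continuous_on_tchar [continuous_intros]: "continuous_on S (tchar \<zeta>)"
  using tchar_has_derivative has_derivative_continuous
  by (metis continuous_at_imp_continuous_on)

lemma pd_eq: "(f has_derivative f') (at z) \<Longrightarrow> pd b f z = f' b"
  unfolding pd_def using frechet_derivative_at by metis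

text \<open>\<open>periodic_fun\<close> grants one positive step along one basis vector. Iteration
  gives natural multiples, reading them backwards gives negative ones, and induction over sets of
  basis vectors assembles a lattice vector.\<close>

lemma periodic_lat:
  assumes f: "periodic_fun f" and \<zeta>: "\<zeta> \<in> lat"
  shows "f (z + (2*pi) *\<^sub>R \<zeta>) = f z"
proof -
  have nat: "f (z + (2*pi*real n) *\<^sub>R b) = f z" if "b \<in> Basis" for z b n
  proof (induction n)
    case (Suc n)
    have "z + (2*pi*real (Suc n)) *\<^sub>R b = (z + (2*pi*real n) *\<^sub>R b) + (2*pi) *\<^sub>R b"
      by (simp add: algebra_simps)
    also have "f \<dots> = f (z + (2*pi*real n) *\<^sub>R b)"
      using f that unfolding periodic_fun_def by blast
    finally show ?case using Suc by simp
  qed simp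
  have int: "f (z + (2*pi * of_int m) *\<^sub>R b) = f z" if b: "b \<in> Basis" for z b m
  proof (cases "m \<ge> 0")
    case True
    then have "real (nat m) = of_int m" by simp
    then show ?thesis using nat[OF b, of z "nat m"] by (simp only:)
  next
    case False
    then have "real (nat (- m)) = - of_int m" by simp
    then have "z + (2*pi * of_int m) *\<^sub>R b + (2*pi*real (nat (- m))) *\<^sub>R b = z" by simp
    then show ?thesis using nat[OF b, of "z + (2*pi * of_int m) *\<^sub>R b" "nat (-m)"] by (simp only:)
  qed
  have "f (z + (\<Sum>b\<in>B. (2*pi*(\<zeta>\<bullet>b)) *\<^sub>R b)) = f z" if "B \<subseteq> Basis" for B
  proof -
    have "finite B" by (rule finite_subset[OF that finite_Basis])
    then show ?thesis using that
    proof (induction B)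
      case (insert b B)
      have "\<zeta> \<bullet> b \<in> \<int>" using \<zeta> insert.prems by (simp add: lat_def)
      then obtain m where m: "\<zeta> \<bullet> b = of_int m" by (rule Ints_cases)
      have "f (z + (\<Sum>b\<in>insert b B. (2*pi*(\<zeta>\<bullet>b)) *\<^sub>R b))
        = f ((z + (\<Sum>b\<in>B. (2*pi*(\<zeta>\<bullet>b)) *\<^sub>R b)) + (2*pi * of_int m) *\<^sub>R b)"
      proof -
        have "(\<Sum>b\<in>insert b B. (2*pi*(\<zeta>\<bullet>b)) *\<^sub>R b) = (\<Sum>b\<in>B. (2*pi*(\<zeta>\<bullet>b)) *\<^sub>R b) + (2*pi * of_int m) *\<^sub>R b"
          using insert.hyps m by (simp add: add.commute)
        then show ?thesis by (simp only: add.assoc)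
      qed
      also have "\<dots> = f (z + (\<Sum>b\<in>B. (2*pi*(\<zeta>\<bullet>b)) *\<^sub>R b))"
        using int insert.prems by blast
      finally show ?case using insert by simp
    qed simp
  qed
  from this[of Basis] have "f (z + (2*pi) *\<^sub>R (\<Sum>b\<in>Basis. (\<zeta>\<bullet>b) *\<^sub>R b)) = f z"
    by (simp add: scaleR_sum_right)
  then show ?thesis by (simp add: euclidean_representation)
qed

text \<open>Removing the integer part of each coordinate, in units of \<open>2*pi\<close>, moves any
  point into the compact cube. Periodic functions are thereby controlled by their values
  there.\<close>

lemma lat_cube_reduce:
  obtains \<zeta> where "\<zeta> \<in> lat" "w + (2*pi) *\<^sub>R \<zeta> \<in> cube"
proof -
  define \<zeta> where "\<zeta> = (\<Sum>b\<in>Basis. of_int (- \<lfloor>(w\<bullet>b)/(2*pi)\<rfloor>) *\<^sub>R b)"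
  have \<zeta>b: "\<zeta> \<bullet> b = of_int (- \<lfloor>(w\<bullet>b)/(2*pi)\<rfloor>)" if "b \<in> Basis" for b
    unfolding \<zeta>_def using that by (subst inner_sum_left_Basis) auto
  show thesis
  proof
    show "\<zeta> \<in> lat" unfolding lat_def using \<zeta>b by auto
    have "0 \<le> w \<bullet> b + 2*pi * of_int (- \<lfloor>(w\<bullet>b)/(2*pi)\<rfloor>)"
         "w \<bullet> b + 2*pi * of_int (- \<lfloor>(w\<bullet>b)/(2*pi)\<rfloor>) \<le> 2*pi" for b
    proof -
      have "of_int \<lfloor>(w\<bullet>b)/(2*pi)\<rfloor> \<le> (w\<bullet>b)/(2*pi)" "(w\<bullet>b)/(2*pi) \<le> of_int \<lfloor>(w\<bullet>b)/(2*pi)\<rfloor> + 1"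
        by linarith+
      then show "0 \<le> w \<bullet> b + 2*pi * of_int (- \<lfloor>(w\<bullet>b)/(2*pi)\<rfloor>)"
         "w \<bullet> b + 2*pi * of_int (- \<lfloor>(w\<bullet>b)/(2*pi)\<rfloor>) \<le> 2*pi"
        using pi_gt_zero by (simp_all add: divide_le_eq le_divide_eq algebra_simps)
    qed
    then show "w + (2*pi) *\<^sub>R \<zeta> \<in> cube"
      unfolding mem_box by (simp add: inner_add_left \<zeta>b mult.assoc)
  qed
qed

lemma periodic_tchar: "\<zeta> \<in> lat \<Longrightarrow> periodic_fun (tchar \<zeta>)"
  unfolding periodic_fun_def tchar_add_right
proof (intro allI ballI)
  fix z b assume "\<zeta> \<in> lat" "b \<in> (Basis :: 'a set)"
  then have "\<zeta> \<bullet> b \<in> \<int>" by (simp add: lat_def)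
  then obtain m where "\<zeta> \<bullet> b = of_int m" by (rule Ints_cases)
  then have "tchar \<zeta> ((2*pi) *\<^sub>R b) = 1"
    by (simp add: tchar_def complex_eq_iff)
  then show "tchar \<zeta> z * tchar \<zeta> ((2*pi) *\<^sub>R b) = tchar \<zeta> z" by simp
qed

text \<open>The slab that leaves the cube on one side re-enters it, shifted by a period, on the other.\<close>
lemma integral_cube_shift_Basis:
  fixes f :: "'a::euclidean_space \<Rightarrow> complex"
  assumes f: "continuous_on UNIV f" "periodic_fun f" and b: "b \<in> Basis" and t: "0 \<le> t" "t \<le> 2*pi"
  shows "integral cube (\<lambda>z. f (z + t *\<^sub>R b)) = integral cube f"
proof -
  have cont: "continuous_on S f" for S using f(1) continuous_on_subset by blast
  have int: "f integrable_on cbox x y" for x y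
    by (rule integrable_continuous) (rule cont)
  define R where "R = (2*pi) *\<^sub>R (One :: 'a)"
  have inR: "R \<bullet> i = 2*pi" if "i \<in> Basis" for i using that by (simp add: R_def)
  have ib: "b \<bullet> i = (if i = b then 1 else 0)" if "i \<in> Basis" for i
    using that b by (auto simp: inner_Basis)
  define Q where "Q = cbox (t *\<^sub>R b) (R + t *\<^sub>R b)"
  \<comment> \<open>\<open>r\<close> is the upper corner of the slab of the cube whose
    \<open>b\<close> coordinate is at most \<open>t\<close>. The overhang of \<open>Q\<close> is
    this slab moved by one period.\<close>
  define r where "r = R + (t - 2*pi) *\<^sub>R b"
  have "integral cube (\<lambda>z. f (z + t *\<^sub>R b)) = integral Q f"
    using integral_shift_cbox_plus[of 0 R f "t *\<^sub>R b"] by (simp add: Q_def R_def o_def add.commute)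
  also have "\<dots> = integral (Q \<inter> {x. x \<bullet> b \<le> 2*pi}) f + integral (Q \<inter> {x. x \<bullet> b \<ge> 2*pi}) f"
    unfolding Q_def by (rule integral_split[OF int b])
  also have "Q \<inter> {x. x \<bullet> b \<le> 2*pi} = cbox (t *\<^sub>R b) R"
    unfolding Q_def interval_split[OF b]
    by (intro arg_cong2[where f = cbox] euclidean_eqI[where 'a = 'a])
       (use t in \<open>auto simp: inR ib inner_add_left inner_diff_left\<close>)
  also have "Q \<inter> {x. x \<bullet> b \<ge> 2*pi} = cbox (0 + (2*pi) *\<^sub>R b) (r + (2*pi) *\<^sub>R b)"
    unfolding Q_def r_def interval_split[OF b]
    by (intro arg_cong2[where f = cbox] euclidean_eqI[where 'a = 'a])
       (use t in \<open>auto simp: inR ib inner_add_left inner_diff_left\<close>)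
  also have "integral \<dots> f = integral (cbox 0 r) (f \<circ> (+) ((2*pi) *\<^sub>R b))"
    by (rule integral_shift_cbox_plus[symmetric])
  also have "f \<circ> (+) ((2*pi) *\<^sub>R b) = f"
    using f(2) b by (auto simp: periodic_fun_def add.commute)
  also have "cbox (t *\<^sub>R b) R = cbox 0 R \<inter> {x. x \<bullet> b \<ge> t}"
    unfolding interval_split[OF b]
    by (intro arg_cong2[where f = cbox] euclidean_eqI[where 'a = 'a])
       (use t in \<open>auto simp: inR ib inner_add_left inner_diff_left\<close>)
  also have "cbox 0 r = cbox 0 R \<inter> {x. x \<bullet> b \<le> t}"
    unfolding r_def interval_split[OF b]
    by (intro arg_cong2[where f = cbox] euclidean_eqI[where 'a = 'a])
       (use t in \<open>auto simp: inR ib inner_add_left inner_diff_left\<close>)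
  also have "integral (cbox 0 R \<inter> {x. t \<le> x \<bullet> b}) f + integral (cbox 0 R \<inter> {x. x \<bullet> b \<le> t}) f = integral (cbox 0 R) f"
    using integral_split[OF int b, of 0 R t] by simp
  finally show ?thesis by (simp add: R_def)
qed

lemma periodic_shift: "periodic_fun f \<Longrightarrow> periodic_fun (\<lambda>z. f (z + w))"
  unfolding periodic_fun_def by (metis add.commute add.left_commute)

lemma continuous_shift:
  fixes f :: "'a::euclidean_space \<Rightarrow> complex"
  shows "continuous_on UNIV f \<Longrightarrow> continuous_on S (\<lambda>z. f (z + w))"
  by (rule continuous_on_compose2[of UNIV f]) (auto intro!: continuous_intros)

text \<open>Lattice periods reduce the shift to a vector with coordinates between 0 and
  \<open>2*pi\<close>, which is then applied one basis direction at a time.\<close>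

lemma integral_cube_shift:
  fixes f :: "'a::euclidean_space \<Rightarrow> complex"
  assumes f: "continuous_on UNIV f" "periodic_fun f"
  shows "integral cube (\<lambda>z. f (z + w)) = integral cube f"
proof -
  obtain \<zeta> where \<zeta>: "\<zeta> \<in> lat" "w + (2*pi) *\<^sub>R \<zeta> \<in> cube" by (rule lat_cube_reduce)
  define v where "v = w + (2*pi) *\<^sub>R \<zeta>"
  have v: "0 \<le> v \<bullet> b" "v \<bullet> b \<le> 2*pi" if "b \<in> Basis" for b
    using \<zeta>(2) that by (auto simp: v_def mem_box)
  have "f (z + w) = f (z + v)" for z
    using periodic_lat[OF f(2) \<zeta>(1), of "z + w"] by (simp add: v_def add.assoc)
  then have "integral cube (\<lambda>z. f (z + w)) = integral cube (\<lambda>z. f (z + v))" by simp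
  also have "integral cube (\<lambda>z. f (z + (\<Sum>b\<in>B. (v\<bullet>b) *\<^sub>R b))) = integral cube f" if "B \<subseteq> Basis" for B
  proof -
    have "finite B" by (rule finite_subset[OF that finite_Basis])
    then show ?thesis using that
    proof (induction B)
      case (insert b B)
      let ?s = "\<Sum>b\<in>B. (v\<bullet>b) *\<^sub>R b"
      have "integral cube (\<lambda>z. f (z + (\<Sum>b\<in>insert b B. (v\<bullet>b) *\<^sub>R b)))
        = integral cube (\<lambda>z. (\<lambda>z. f (z + ?s)) (z + (v\<bullet>b) *\<^sub>R b))"
        using insert.hyps by (simp add: algebra_simps)
      also have "\<dots> = integral cube (\<lambda>z. f (z + ?s))"
        using insert.prems v by (intro integral_cube_shift_Basis periodic_shift continuous_shift f) auto
      finally show ?case using insert by simp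
    qed simp
  qed
  from this[of Basis] have "integral cube (\<lambda>z. f (z + v)) = integral cube f"
    by (simp add: euclidean_representation)
  finally show ?thesis .
qed

text \<open>Differentiate the constant \<open>t \<mapsto> \<integral> f (z + t b) dz\<close> at \<open>t = 0\<close>.\<close>
lemma integral_cube_pd:
  fixes f :: "'a::euclidean_space \<Rightarrow> complex"
  assumes f: "\<And>z. f differentiable (at z)" "periodic_fun f" "continuous_on UNIV (pd b f)"
  shows "integral cube (pd b f) = 0"
proof -
  have cont: "continuous_on UNIV f"
    using f(1) by (simp add: continuous_at_imp_continuous_on differentiable_imp_continuous_within)
  have "((\<lambda>t. integral cube (\<lambda>z. f (z + t *\<^sub>R b))) has_vector_derivative
      integral cube (\<lambda>z. pd b f (z + 0 *\<^sub>R b))) (at 0 within UNIV)"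
  proof (rule leibniz_rule_vector_derivative)
    fix t :: real and z :: 'a
    have 1: "(f has_derivative frechet_derivative f (at (z + t *\<^sub>R b))) (at (z + t *\<^sub>R b))"
      using f(1) frechet_derivative_works by blast
    have "((\<lambda>t. z + t *\<^sub>R b) has_derivative (\<lambda>t. t *\<^sub>R b)) (at t)"
      by (rule has_derivative_eq_rhs, (rule derivative_intros)+) auto
    from diff_chain_at[OF this 1]
    have "((\<lambda>t. f (z + t *\<^sub>R b)) has_derivative (\<lambda>s. frechet_derivative f (at (z + t *\<^sub>R b)) (s *\<^sub>R b))) (at t)"
      by (simp add: o_def)
    moreover have "frechet_derivative f (at (z + t *\<^sub>R b)) (s *\<^sub>R b) = s *\<^sub>R pd b f (z + t *\<^sub>R b)" for s
      unfolding pd_def using has_derivative_linear[OF 1] by (simp add: linear_cmul)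
    ultimately show "((\<lambda>t. f (z + t *\<^sub>R b)) has_vector_derivative pd b f (z + t *\<^sub>R b)) (at t within UNIV)"
      by (simp add: has_vector_derivative_def)
  next
    fix t show "(\<lambda>z. f (z + t *\<^sub>R b)) integrable_on cube"
      by (intro integrable_continuous continuous_shift cont)
  next
    show "continuous_on (UNIV \<times> cube) (\<lambda>(t, z). pd b f (z + t *\<^sub>R b))"
      unfolding split_def
      by (rule continuous_on_compose2[OF f(3)]) (auto intro!: continuous_intros)
  qed auto
  moreover have "(\<lambda>t. integral cube (\<lambda>z. f (z + t *\<^sub>R b))) = (\<lambda>t. integral cube f)"
    using integral_cube_shift[OF cont f(2)] by auto
  ultimately have "((\<lambda>t::real. integral cube f) has_vector_derivative integral cube (pd b f)) (at 0)"
    by simp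
  moreover have "((\<lambda>t::real. integral cube f) has_vector_derivative 0) (at 0)"
    by (rule has_vector_derivative_const)
  ultimately show ?thesis by (rule vector_derivative_unique_at)
qed

lemma pd_tchar: "pd b (tchar \<zeta>) = (\<lambda>z. (\<i> * of_real (\<zeta> \<bullet> b)) * tchar \<zeta> z)"
proof
  show "pd b (tchar \<zeta>) z = (\<i> * of_real (\<zeta> \<bullet> b)) * tchar \<zeta> z" for z
    by (rule pd_eq[OF tchar_has_derivative])
qed

lemma measure_cube: "measure lborel (cube :: 'a::euclidean_space set) = (2*pi) ^ DIM('a)"
  by (subst content_cbox) auto

text \<open>At a nonzero frequency the character is a multiple of one of its own partial
  derivatives, and such a derivative has integral zero over a period.\<close>

lemma integral_cube_tchar:
  fixes \<zeta> :: "'a::euclidean_space"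
  assumes "\<zeta> \<in> lat"
  shows "integral cube (tchar \<zeta>) = (if \<zeta> = 0 then (2*pi) ^ DIM('a) else 0)"
proof (cases "\<zeta> = 0")
  case True
  have "tchar (0::'a) = (\<lambda>_. 1)" by (simp add: fun_eq_iff)
  then show ?thesis using True by (simp add: scaleR_conv_of_real measure_cube)
next
  case False
  then obtain b where b: "b \<in> Basis" "\<zeta> \<bullet> b \<noteq> 0"
    using euclidean_all_zero_iff by blast
  have "integral cube (pd b (tchar \<zeta>)) = 0"
  proof (rule integral_cube_pd)
    show "tchar \<zeta> differentiable at z" for z
      using tchar_has_derivative differentiable_def by blast
    show "continuous_on UNIV (pd b (tchar \<zeta>))"
      unfolding pd_tchar by (intro continuous_intros)
  qed (rule periodic_tchar[OF assms])
  then have "(\<i> * of_real (\<zeta> \<bullet> b)) * integral cube (tchar \<zeta>) = 0"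
    unfolding pd_tchar by (simp only: integral_mult_right)
  then show ?thesis using False b by auto
qed

section \<open>Rapidly decaying Fourier series\<close>

text \<open>The subtracted term makes the induction telescope: the two new summands together are at
  most \<open>2 / (1 + m) - 2 / (2 + m)\<close>. What matters later is the bound 4, uniform in
  \<open>m\<close>.\<close>

lemma sum_inverse_square_symmetric_interval:
  "(\<Sum>j=-int m..int m. 1 / (1 + real_of_int \<bar>j\<bar>)^2) \<le> 4 - 2 / (1 + real m)"
proof (induction m)
  case (Suc m)
  have eq: "{-int (Suc m)..int (Suc m)} = insert (int (Suc m)) (insert (-int (Suc m)) {-int m..int m})"
    by auto
  have "2 / (2 + real m)^2 \<le> 2 / ((1 + real m) * (2 + real m))"
    by (intro divide_left_mono) (auto simp: power2_eq_square mult_right_mono)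
  also have "\<dots> = 2 / (1 + real m) - 2 / (2 + real m)"
    by (simp add: field_simps)
  finally have "2 / (2 + real m)^2 \<le> 2 / (1 + real m) - 2 / (2 + real m)" .
  then show ?case
    using Suc unfolding eq by (simp add: add.assoc)
qed simp

text \<open>Coordinates are bounded by the norm, so the weight is at most a product of one inverse
  square per coordinate; hence the exponent. Over a box the sum of these products factorises into
  one-dimensional sums, which bounds all finite partial sums.\<close>

lemma summable_on_lat:
  "(\<lambda>\<zeta>. 1 / (1 + norm \<zeta>) ^ (2 * DIM('a))) summable_on (lat :: 'a::euclidean_space set)"
proof -
  define w where "w = (\<lambda>\<zeta>::'a. \<Prod>b\<in>Basis. 1 / (1 + \<bar>\<zeta>\<bullet>b\<bar>)^2)"
  have "w summable_on lat"
  proof (rule nonneg_bdd_above_summable_on)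
    show "0 \<le> w \<zeta>" for \<zeta> unfolding w_def by (intro prod_nonneg) auto
    show "bdd_above (sum w ` {F. F \<subseteq> lat \<and> finite F})"
    proof (rule bdd_aboveI2)
      fix F assume "F \<in> {F. F \<subseteq> (lat :: 'a set) \<and> finite F}"
      then have F: "F \<subseteq> lat" "finite F" by auto
      \<comment> \<open>The sum of the norms dominates each of them, so the box with bound
        \<open>m\<close> contains all of \<open>F\<close>.\<close>
      define m where "m = nat \<lceil>\<Sum>\<zeta>\<in>F. norm \<zeta>\<rceil>"
      \<comment> \<open>Lattice points are recoded as integer-valued functions on the basis, so that
        the sum over the box \<open>?P\<close> can be factorised.\<close>
      define g where "g = (\<lambda>\<zeta>::'a. restrict (\<lambda>b. \<lfloor>\<zeta>\<bullet>b\<rfloor>) Basis)"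
      let ?P = "PiE (Basis :: 'a set) (\<lambda>_. {-int m..int m})"
      let ?f = "\<lambda>j::int. 1 / (1 + real_of_int \<bar>j\<bar>)^2"
      have fl: "of_int \<lfloor>\<zeta>\<bullet>b\<rfloor> = \<zeta>\<bullet>b" if "\<zeta> \<in> F" "b \<in> Basis" for \<zeta> b
      proof -
        have "\<zeta>\<bullet>b \<in> \<int>" using F that by (auto simp: lat_def)
        then show ?thesis by (auto elim: Ints_cases)
      qed
      have inj: "inj_on g F"
      proof (rule inj_onI)
        fix \<zeta> \<eta> assume h: "\<zeta> \<in> F" "\<eta> \<in> F" "g \<zeta> = g \<eta>"
        show "\<zeta> = \<eta>"
        proof (rule euclidean_eqI)
          fix b :: 'a assume b: "b \<in> Basis"
          have "g \<zeta> b = g \<eta> b" using h by simp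
          then have "\<lfloor>\<zeta>\<bullet>b\<rfloor> = \<lfloor>\<eta>\<bullet>b\<rfloor>" using b by (simp add: g_def)
          then show "\<zeta>\<bullet>b = \<eta>\<bullet>b" using fl[OF h(1) b] fl[OF h(2) b] by metis
        qed
      qed
      have gP: "g ` F \<subseteq> ?P"
      proof (rule image_subsetI)
        fix \<zeta> assume z: "\<zeta> \<in> F"
        have "norm \<zeta> \<le> (\<Sum>\<zeta>\<in>F. norm \<zeta>)" using z F by (intro member_le_sum) auto
        also have "\<dots> \<le> real m" unfolding m_def by linarith
        finally have n: "norm \<zeta> \<le> real m" .
        have "\<lfloor>\<zeta>\<bullet>b\<rfloor> \<in> {-int m..int m}" if b: "b \<in> Basis" for b
        proof -
          have "\<bar>\<zeta>\<bullet>b\<bar> \<le> real m" using n Basis_le_norm[OF b, of \<zeta>] by linarith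
          then have "\<bar>real_of_int \<lfloor>\<zeta>\<bullet>b\<rfloor>\<bar> \<le> real m" by (simp only: fl[OF z b])
          then show ?thesis by auto
        qed
        then show "g \<zeta> \<in> ?P" by (auto simp: g_def)
      qed
      have "sum w F = (\<Sum>\<zeta>\<in>F. \<Prod>b\<in>Basis. ?f (g \<zeta> b))"
        unfolding w_def
      proof (intro sum.cong prod.cong refl)
        fix \<zeta> b assume zb: "\<zeta> \<in> F" "b \<in> (Basis :: 'a set)"
        have "real_of_int \<bar>\<lfloor>\<zeta>\<bullet>b\<rfloor>\<bar> = \<bar>\<zeta>\<bullet>b\<bar>" by (simp only: of_int_abs fl[OF zb])
        then show "1 / (1 + \<bar>\<zeta>\<bullet>b\<bar>)^2 = ?f (g \<zeta> b)" using zb by (simp add: g_def)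
      qed
      also have "\<dots> = (\<Sum>h\<in>g ` F. \<Prod>b\<in>Basis. ?f (h b))"
        using inj by (simp add: sum.reindex)
      also have "\<dots> \<le> (\<Sum>h\<in>?P. \<Prod>b\<in>Basis. ?f (h b))"
        using gP by (intro sum_mono2 finite_PiE prod_nonneg) auto
      also have "\<dots> = (\<Prod>b\<in>(Basis::'a set). \<Sum>j=-int m..int m. ?f j)"
        by (rule prod_sum_PiE[symmetric]) auto
      also have "\<dots> \<le> (\<Prod>b\<in>(Basis::'a set). 4)"
      proof (intro prod_mono conjI sum_nonneg)
        have "0 \<le> 2 / (1 + real m)" by simp
        then show "(\<Sum>j=-int m..int m. ?f j) \<le> 4"
          using sum_inverse_square_symmetric_interval[of m] by linarith
      qed auto
      finally show "sum w F \<le> (\<Prod>b\<in>(Basis::'a set). 4)" .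
    qed
  qed
  then show ?thesis
  proof (rule summable_on_comparison_test)
    fix \<zeta> :: 'a
    have "(\<Prod>b\<in>(Basis::'a set). 1 / (1 + norm \<zeta>)^2) \<le> w \<zeta>"
      unfolding w_def
    proof (intro prod_mono conjI)
      fix b :: 'a assume "b \<in> Basis"
      then show "1 / (1 + norm \<zeta>)^2 \<le> 1 / (1 + \<bar>\<zeta>\<bullet>b\<bar>)^2"
        using Basis_le_norm[of b \<zeta>] by (intro divide_left_mono power_mono) (auto intro!: mult_pos_pos add_pos_nonneg)
    qed auto
    then show "1 / (1 + norm \<zeta>) ^ (2 * DIM('a)) \<le> w \<zeta>"
      by (simp add: power_mult power_divide)
  qed auto
qed

lemma rapid_summable:
  assumes "rapid a"
  shows "(\<lambda>\<zeta>. norm (a \<zeta>) * (1 + norm \<zeta>) ^ m) summable_on (lat :: 'a::euclidean_space set)"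
proof -
  obtain C where C: "\<And>\<zeta>::'a. \<zeta> \<in> lat \<Longrightarrow> norm (a \<zeta>) * (1 + norm \<zeta>) ^ (m + 2 * DIM('a)) \<le> C"
    using assms unfolding rapid_def by metis
  show ?thesis
  proof (rule summable_on_comparison_test[OF summable_on_cmult_right[OF summable_on_lat, of C]])
    fix \<zeta> :: 'a assume "\<zeta> \<in> lat"
    then show "norm (a \<zeta>) * (1 + norm \<zeta>) ^ m \<le> C * (1 / (1 + norm \<zeta>) ^ (2 * DIM('a)))"
      using C[of \<zeta>] by (simp add: power_add pos_le_divide_eq add_pos_nonneg mult.assoc)
  qed auto
qed

lemma rapid_norm_summable: "rapid a \<Longrightarrow> (\<lambda>\<zeta>. norm (a \<zeta>)) summable_on lat"
  using rapid_summable[of a 0] by simp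

text \<open>Rapid decay absorbs any polynomial loss. This one estimate serves differentiation,
  division by the symbol and normalising constants.\<close>

lemma rapid_dominated:
  assumes "rapid a" "\<And>\<zeta>. \<zeta> \<in> lat \<Longrightarrow> norm (b \<zeta>) \<le> K * (1 + norm \<zeta>) ^ k * norm (a \<zeta>)"
  shows "rapid b"
  unfolding rapid_def
proof
  fix m
  obtain C where C: "\<And>\<zeta>. \<zeta> \<in> lat \<Longrightarrow> norm (a \<zeta>) * (1 + norm \<zeta>) ^ (k + m) \<le> C"
    using assms(1) unfolding rapid_def by metis
  have "norm (b \<zeta>) * (1 + norm \<zeta>) ^ m \<le> \<bar>K\<bar> * C" if z: "\<zeta> \<in> lat" for \<zeta>
  proof -
    have "norm (b \<zeta>) * (1 + norm \<zeta>) ^ m \<le> (K * (1 + norm \<zeta>) ^ k * norm (a \<zeta>)) * (1 + norm \<zeta>) ^ m"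
      using assms(2)[OF z] by (intro mult_right_mono) auto
    also have "\<dots> = K * (norm (a \<zeta>) * (1 + norm \<zeta>) ^ (k + m))"
      by (simp add: power_add)
    also have "\<dots> \<le> \<bar>K\<bar> * (norm (a \<zeta>) * (1 + norm \<zeta>) ^ (k + m))"
      by (intro mult_right_mono) auto
    also have "\<dots> \<le> \<bar>K\<bar> * C" using C[OF z] by (intro mult_left_mono) auto
    finally show ?thesis .
  qed
  then show "\<exists>C. \<forall>\<zeta>\<in>lat. norm (b \<zeta>) * (1 + norm \<zeta>) ^ m \<le> C" by blast
qed

lemma rapid_finite_support:
  assumes "finite {\<zeta>\<in>lat. a \<zeta> \<noteq> 0}"
  shows "rapid a"
  unfolding rapid_def
proof
  fix m
  let ?S = "\<Sum>\<zeta>\<in>{\<zeta>\<in>lat. a \<zeta> \<noteq> 0}. norm (a \<zeta>) * (1 + norm \<zeta>) ^ m"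
  have "norm (a \<zeta>) * (1 + norm \<zeta>) ^ m \<le> ?S" if "\<zeta> \<in> lat" for \<zeta>
  proof (cases "a \<zeta> = 0")
    case True then show ?thesis by (simp add: sum_nonneg)
  next
    case False then show ?thesis
      using that assms by (intro member_le_sum[of \<zeta> _ "\<lambda>\<zeta>. norm (a \<zeta>) * (1 + norm \<zeta>) ^ m"]) auto
  qed
  then show "\<exists>C. \<forall>\<zeta>\<in>lat. norm (a \<zeta>) * (1 + norm \<zeta>) ^ m \<le> C" by blast
qed

lemma rapid_mult_inner:
  assumes "rapid a"
  shows "rapid (\<lambda>\<zeta>. (\<i> * of_real (\<zeta> \<bullet> b)) * a \<zeta>)"
proof (rule rapid_dominated[OF assms, of _ "norm b" 1])
  fix \<zeta>
  have "\<bar>\<zeta> \<bullet> b\<bar> \<le> norm b * (1 + norm \<zeta>)"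
    using Cauchy_Schwarz_ineq2[of \<zeta> b] by (simp add: distrib_left mult.commute add_increasing)
  then show "norm ((\<i> * of_real (\<zeta> \<bullet> b)) * a \<zeta>) \<le> norm b * (1 + norm \<zeta>) ^ 1 * norm (a \<zeta>)"
    by (simp add: norm_mult mult_right_mono)
qed

lemma norm_fseries_summand_summable:
  "rapid a \<Longrightarrow> (\<lambda>\<zeta>. norm (a \<zeta> * tchar \<zeta> z)) summable_on lat"
  by (simp add: norm_mult rapid_norm_summable)

lemma fseries_has_sum: "rapid a \<Longrightarrow> ((\<lambda>\<zeta>. a \<zeta> * tchar \<zeta> z) has_sum fseries a z) lat"
  unfolding fseries_def
  by (rule has_sum_infsum[OF abs_summable_summable[OF norm_fseries_summand_summable]])

lemma norm_fseries_le: "rapid a \<Longrightarrow> norm (fseries a z) \<le> (\<Sum>\<^sub>\<infinity>\<zeta>\<in>lat. norm (a \<zeta>))"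
  using norm_infsum_bound[OF norm_fseries_summand_summable, of a z]
  by (simp add: fseries_def norm_mult)

section \<open>Termwise differentiation of Fourier series\<close>

lemma has_sum_minus:
  fixes f g :: "'b \<Rightarrow> complex"
  shows "(f has_sum S) A \<Longrightarrow> (g has_sum T) A \<Longrightarrow> ((\<lambda>x. f x - g x) has_sum (S - T)) A"
  using has_sum_add[OF _ has_sum_uminusI, of f A S g T] by simp

lemma norm_cis_diff_linear: "norm (cis x - 1 - \<i> * of_real x) \<le> x^2"
  using Taylor_exp[of "\<i> * of_real x" 1]
  by (simp add: cis_conv_exp norm_mult diff_diff_eq power2_eq_square)

text \<open>The second-order remainder of each term is at most
  \<open>norm (a \<zeta>) * (1 + norm \<zeta>) ^ 2 * norm h ^ 2\<close>. The weighted coefficients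
  are summable with sum \<open>K\<close>, so the whole remainder is \<open>O(norm h ^ 2)\<close> and
  the total derivative is obtained in one stroke.\<close>

lemma fseries_has_derivative:
  assumes "rapid (a :: 'a::euclidean_space \<Rightarrow> complex)"
  shows "(fseries a has_derivative (\<lambda>h. \<Sum>\<^sub>\<infinity>\<zeta>\<in>lat. a \<zeta> * (\<i> * of_real (\<zeta> \<bullet> h) * tchar \<zeta> z))) (at z)"
proof -
  let ?L = "\<lambda>h \<zeta>. a \<zeta> * (\<i> * of_real (\<zeta> \<bullet> h) * tchar \<zeta> z)"
  define K where "K = (\<Sum>\<^sub>\<infinity>\<zeta>::'a\<in>lat. norm (a \<zeta>) * (1 + norm \<zeta>) ^ 2)"
  have L_sum: "?L h summable_on lat" for h
  proof -
    have "?L h = (\<lambda>\<zeta>. ((\<i> * of_real (\<zeta> \<bullet> h)) * a \<zeta>) * tchar \<zeta> z)"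
      by (simp add: fun_eq_iff algebra_simps)
    then show ?thesis
      using fseries_has_sum[OF rapid_mult_inner[OF assms, of h], of z] by (simp add: has_sum_iff)
  qed
  define L where "L = (\<lambda>h. \<Sum>\<^sub>\<infinity>\<zeta>\<in>lat. ?L h \<zeta>)"
  have quad: "norm (fseries a (z + h) - fseries a z - L h) \<le> K * norm h ^ 2" for h
  proof -
    have "((\<lambda>\<zeta>. a \<zeta> * tchar \<zeta> (z + h) - a \<zeta> * tchar \<zeta> z - ?L h \<zeta>) has_sum
        (fseries a (z + h) - fseries a z - L h)) lat"
      unfolding L_def by (intro has_sum_minus fseries_has_sum assms has_sum_infsum L_sum)
    moreover have "((\<lambda>\<zeta>. (norm (a \<zeta>) * (1 + norm \<zeta>) ^ 2) * norm h ^ 2) has_sum K * norm h ^ 2) lat"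
      unfolding K_def by (intro has_sum_cmult_left has_sum_infsum rapid_summable assms)
    moreover have "norm (a \<zeta> * tchar \<zeta> (z + h) - a \<zeta> * tchar \<zeta> z - ?L h \<zeta>)
      \<le> (norm (a \<zeta>) * (1 + norm \<zeta>) ^ 2) * norm h ^ 2" for \<zeta>
    proof -
      have "a \<zeta> * tchar \<zeta> (z + h) - a \<zeta> * tchar \<zeta> z - ?L h \<zeta>
        = a \<zeta> * tchar \<zeta> z * (cis (\<zeta> \<bullet> h) - 1 - \<i> * of_real (\<zeta> \<bullet> h))"
        unfolding tchar_add_right by (simp add: tchar_def[of \<zeta> h] algebra_simps)
      then have "norm (a \<zeta> * tchar \<zeta> (z + h) - a \<zeta> * tchar \<zeta> z - ?L h \<zeta>)
          \<le> norm (a \<zeta>) * (\<zeta> \<bullet> h)^2"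
        using norm_cis_diff_linear[of "\<zeta> \<bullet> h"] by (simp add: norm_mult mult_left_mono)
      also have "(\<zeta> \<bullet> h)^2 \<le> ((1 + norm \<zeta>) * norm h)^2"
      proof -
        have "\<bar>\<zeta> \<bullet> h\<bar> \<le> (1 + norm \<zeta>) * norm h"
          using Cauchy_Schwarz_ineq2[of \<zeta> h] by (simp add: distrib_right add_increasing)
        then show ?thesis by (metis abs_ge_zero power2_abs power_mono)
      qed
      finally show ?thesis by (simp add: power_mult_distrib mult_left_mono mult.assoc)
    qed
    ultimately show ?thesis
      by (rule norm_infsum_le)
  qed
  have lin: "linear L"
  proof
    fix x y
    have "((\<lambda>\<zeta>. ?L x \<zeta> + ?L y \<zeta>) has_sum L x + L y) lat"
      unfolding L_def by (intro has_sum_add has_sum_infsum L_sum)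
    then have "((\<lambda>\<zeta>. ?L (x + y) \<zeta>) has_sum L x + L y) lat"
      by (simp add: inner_add_right algebra_simps)
    then show "L (x + y) = L x + L y"
      unfolding L_def by (rule infsumI)
  next
    fix r x
    have "((\<lambda>\<zeta>. r *\<^sub>R ?L x \<zeta>) has_sum r *\<^sub>R L x) lat"
      unfolding L_def by (intro has_sum_scaleR has_sum_infsum L_sum)
    then have "((\<lambda>\<zeta>. ?L (r *\<^sub>R x) \<zeta>) has_sum r *\<^sub>R L x) lat"
      by (simp add: scaleR_conv_of_real algebra_simps)
    then show "L (r *\<^sub>R x) = r *\<^sub>R L x"
      unfolding L_def by (rule infsumI)
  qed
  have "(fseries a has_derivative L) (at z)"
    unfolding has_derivative_at
  proof
    show "bounded_linear L" using lin by (simp add: linear_conv_bounded_linear)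
    show "(\<lambda>h. norm (fseries a (z + h) - fseries a z - L h) / norm h) \<midarrow>0\<rightarrow> 0"
    proof (rule tendsto_sandwich[of "\<lambda>_. 0" _ _ "\<lambda>h. K * norm h"])
      show "\<forall>\<^sub>F h in at 0. norm (fseries a (z + h) - fseries a z - L h) / norm h \<le> K * norm h"
        using eventually_neq_at_within
      proof (rule eventually_mono)
        fix h :: 'a assume "h \<noteq> 0"
        then show "norm (fseries a (z + h) - fseries a z - L h) / norm h \<le> K * norm h"
          using quad[of h] by (simp add: divide_le_eq power2_eq_square mult.assoc)
      qed
      show "(\<lambda>h::'a. K * norm h) \<midarrow>0\<rightarrow> 0" by (auto intro!: tendsto_eq_intros)
    qed auto
  qed
  then show ?thesis by (simp add: L_def)
qed

lemma pd_fseries: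
  assumes "rapid a"
  shows "pd b (fseries a) = fseries (\<lambda>\<zeta>. (\<i> * of_real (\<zeta> \<bullet> b)) * a \<zeta>)"
proof
  fix z
  have "pd b (fseries a) z = (\<Sum>\<^sub>\<infinity>\<zeta>\<in>lat. a \<zeta> * (\<i> * of_real (\<zeta> \<bullet> b) * tchar \<zeta> z))"
    by (rule pd_eq[OF fseries_has_derivative[OF assms]])
  also have "\<dots> = fseries (\<lambda>\<zeta>. (\<i> * of_real (\<zeta> \<bullet> b)) * a \<zeta>) z"
    unfolding fseries_def by (rule infsum_cong) (simp add: algebra_simps)
  finally show "pd b (fseries a) z = fseries (\<lambda>\<zeta>. (\<i> * of_real (\<zeta> \<bullet> b)) * a \<zeta>) z" .
qed

lemma fseries_differentiable: "rapid a \<Longrightarrow> fseries a differentiable (at z)"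
  using fseries_has_derivative differentiable_def by blast

lemma continuous_on_fseries: "rapid a \<Longrightarrow> continuous_on S (fseries a)"
  by (simp add: continuous_at_imp_continuous_on differentiable_imp_continuous_within fseries_differentiable)

lemma periodic_fseries: "periodic_fun (fseries a)"
  unfolding periodic_fun_def fseries_def
proof (intro allI ballI infsum_cong)
  fix z b \<zeta> :: 'a assume "b \<in> Basis" "\<zeta> \<in> lat"
  then have "tchar \<zeta> (z + (2*pi) *\<^sub>R b) = tchar \<zeta> z"
    using periodic_tchar[of \<zeta>] unfolding periodic_fun_def by blast
  then show "a \<zeta> * tchar \<zeta> (z + (2*pi) *\<^sub>R b) = a \<zeta> * tchar \<zeta> z" by simp
qed

lemma fseries_Cinf:
  assumes "rapid a" shows "fseries a \<in> Cinf_torus"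
proof -
  have "Ck k (fseries a)" if "rapid a" for k and a :: "'a \<Rightarrow> complex"
    using that
  proof (induction k arbitrary: a)
    case (Suc k)
    then show ?case by (simp add: fseries_differentiable pd_fseries rapid_mult_inner)
  qed (simp add: continuous_on_fseries)
  then show ?thesis using assms by (simp add: Cinf_torus_def smooth_fun_def periodic_fseries)
qed

text \<open>Rapid decay of the new coefficients is carried through the induction, since it licenses
  the next termwise derivative.\<close>

lemma dlist_fseries:
  assumes "rapid a"
  shows "dlist bs (fseries a) = fseries (\<lambda>\<zeta>. (\<Prod>b\<leftarrow>bs. \<i> * of_real (\<zeta> \<bullet> b)) * a \<zeta>)
    \<and> rapid (\<lambda>\<zeta>. (\<Prod>b\<leftarrow>bs. \<i> * of_real (\<zeta> \<bullet> b)) * a \<zeta>)"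
proof (induction bs)
  case (Cons b bs)
  let ?a = "\<lambda>\<zeta>. (\<Prod>b\<leftarrow>bs. \<i> * complex_of_real (\<zeta> \<bullet> b)) * a \<zeta>"
  show ?case
    using Cons pd_fseries[of ?a b] rapid_mult_inner[of ?a b] by (simp add: mult.assoc)
qed (simp add: assms)

lemma fseries_finite:
  assumes "finite F" "F \<subseteq> lat"
  shows "fseries (\<lambda>\<zeta>. if \<zeta> \<in> F then a \<zeta> else 0) z = (\<Sum>\<zeta>\<in>F. a \<zeta> * tchar \<zeta> z)"
proof -
  have "fseries (\<lambda>\<zeta>. if \<zeta> \<in> F then a \<zeta> else 0) z = (\<Sum>\<^sub>\<infinity>\<zeta>\<in>F. a \<zeta> * tchar \<zeta> z)"
    unfolding fseries_def using assms by (intro infsum_cong_neutral) auto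
  then show ?thesis using assms by simp
qed

lemma tchar_eq_fseries: "\<zeta> \<in> lat \<Longrightarrow> tchar \<zeta> = fseries (\<lambda>\<eta>. if \<eta> \<in> {\<zeta>} then 1 else 0)"
  by (rule ext) (subst fseries_finite[of "{\<zeta>}"], auto)

lemma tchar_Cinf: "\<zeta> \<in> lat \<Longrightarrow> tchar \<zeta> \<in> Cinf_torus"
  by (subst tchar_eq_fseries) (auto intro!: fseries_Cinf rapid_finite_support)

section \<open>Fourier coefficients of smooth functions\<close>

lemma CinfD:
  assumes "f \<in> Cinf_torus"
  shows "f differentiable (at z)" "continuous_on S f" "periodic_fun f"
proof -
  have "Ck 0 f" "Ck (Suc 0) f" and p: "periodic_fun f"
    using assms by (auto simp: Cinf_torus_def smooth_fun_def)
  then show "f differentiable (at z)" "continuous_on S f"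
    by (auto intro: continuous_on_subset)
  show "periodic_fun f" by (rule p)
qed

lemma pd_periodic:
  assumes "f differentiable (at z)" "f differentiable (at (z + w))" "\<And>z. f (z + w) = f z"
  shows "pd b f (z + w) = pd b f z"
proof -
  have 1: "(f has_derivative frechet_derivative f (at (z + w))) (at (z + w))"
    using assms(2) frechet_derivative_works by blast
  have "((\<lambda>z. z + w) has_derivative (\<lambda>h. h)) (at z)"
    by (rule has_derivative_eq_rhs, (rule derivative_intros)+) auto
  from diff_chain_at[OF this 1] have "(f has_derivative frechet_derivative f (at (z + w))) (at z)"
    by (simp add: o_def assms(3))
  from pd_eq[OF this, of b] show ?thesis by (simp add: pd_def)
qed

lemma pd_Cinf:
  assumes "f \<in> Cinf_torus" "b \<in> Basis"
  shows "pd b f \<in> Cinf_torus"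
proof -
  have "Ck (Suc k) f" for k using assms by (simp add: Cinf_torus_def smooth_fun_def)
  then have "smooth_fun (pd b f)" using assms(2) by (simp add: smooth_fun_def)
  moreover have "periodic_fun (pd b f)"
    unfolding periodic_fun_def
  proof (intro allI ballI)
    fix z c :: 'a assume "c \<in> Basis"
    then show "pd b f (z + (2*pi) *\<^sub>R c) = pd b f z"
      using CinfD[OF assms(1)] by (intro pd_periodic) (auto simp: periodic_fun_def)
  qed
  ultimately show ?thesis by (simp add: Cinf_torus_def)
qed

lemma dlist_Cinf: "f \<in> Cinf_torus \<Longrightarrow> set bs \<subseteq> Basis \<Longrightarrow> dlist bs f \<in> Cinf_torus"
  by (induction bs) (auto intro: pd_Cinf)

lemma pd_cmult:
  assumes "\<And>z. f differentiable (at z)"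
  shows "pd b (\<lambda>z. c * f z) = (\<lambda>z. c * pd b f z)"
proof
  fix z
  have "(f has_derivative frechet_derivative f (at z)) (at z)"
    using assms frechet_derivative_works by blast
  from pd_eq[OF has_derivative_mult_right[OF this], of b c] show "pd b (\<lambda>z. c * f z) z = c * pd b f z"
    by (simp add: pd_def)
qed

lemma Cinf_cmult:
  assumes "f \<in> Cinf_torus"
  shows "(\<lambda>z. c * f z) \<in> Cinf_torus"
proof -
  have "Ck k (\<lambda>z. c * f z)" if "Ck k f" for k and f :: "'a \<Rightarrow> complex"
    using that
  proof (induction k arbitrary: f)
    case (Suc k)
    then show ?case by (simp add: pd_cmult)
  qed (simp add: continuous_on_mult_left)
  then show ?thesis using assms by (simp add: Cinf_torus_def smooth_fun_def periodic_fun_def)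
qed

lemma dlist_cmult:
  assumes "f \<in> Cinf_torus" "set bs \<subseteq> Basis"
  shows "dlist bs (\<lambda>z. c * f z) = (\<lambda>z. c * dlist bs f z)"
  using assms(2)
proof (induction bs)
  case (Cons b bs)
  then have "dlist bs f \<in> Cinf_torus" using assms dlist_Cinf by auto
  then show ?case using Cons by (simp add: pd_cmult CinfD(1))
qed simp

lemma periodic_bounded:
  fixes f :: "'a::euclidean_space \<Rightarrow> complex"
  assumes "continuous_on UNIV f" "periodic_fun f"
  obtains M where "\<And>z. norm (f z) \<le> M"
proof -
  have "compact (f ` cube)"
    by (intro compact_continuous_image continuous_on_subset[OF assms(1)]) auto
  then obtain M where M: "\<And>z. z \<in> cube \<Longrightarrow> norm (f z) \<le> M"
    by (metis bounded_iff compact_imp_bounded imageI)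
  have "norm (f z) \<le> M" for z
  proof -
    obtain \<zeta> where \<zeta>: "\<zeta> \<in> lat" "z + (2*pi) *\<^sub>R \<zeta> \<in> cube" by (rule lat_cube_reduce)
    show ?thesis using M[OF \<zeta>(2)] periodic_lat[OF assms(2) \<zeta>(1), of z] by simp
  qed
  then show ?thesis using that by blast
qed

lemma norm_fcoef_le:
  fixes f :: "'a::euclidean_space \<Rightarrow> complex"
  assumes "continuous_on UNIV f" "\<And>z. norm (f z) \<le> M"
  shows "norm (fcoef f \<zeta>) \<le> M * (2*pi) ^ DIM('a)"
proof -
  have "norm (fcoef f \<zeta>) \<le> M * measure lborel (cube :: 'a set)"
    unfolding fcoef_def
  proof (rule integrable_bound)
    show "0 \<le> M" using assms(2)[of 0] norm_ge_zero order_trans by blast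
    show "(\<lambda>z. f z * tchar (-\<zeta>) z) integrable_on cube"
      by (intro integrable_continuous continuous_intros continuous_on_subset[OF assms(1)]) auto
    show "norm (f z * tchar (-\<zeta>) z) \<le> M" for z using assms(2) by (simp add: norm_mult)
  qed
  then show ?thesis by (simp add: measure_cube)
qed

text \<open>Integration by parts: the product of \<open>f\<close> with the character of
  \<open>-\<zeta>\<close> is periodic, so its derivative integrates to zero, and the product rule
  splits that integral.\<close>

lemma fcoef_pd:
  fixes f :: "'a::euclidean_space \<Rightarrow> complex"
  assumes "f \<in> Cinf_torus" "b \<in> Basis" "\<zeta> \<in> lat"
  shows "fcoef (pd b f) \<zeta> = (\<i> * of_real (\<zeta> \<bullet> b)) * fcoef f \<zeta>"
proof -
  let ?g = "\<lambda>z. f z * tchar (-\<zeta>) z"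
  let ?c = "\<i> * complex_of_real (\<zeta> \<bullet> b)"
  have deriv: "(?g has_derivative (\<lambda>h. f z * (\<i> * of_real ((-\<zeta>) \<bullet> h) * tchar (-\<zeta>) z) +
      frechet_derivative f (at z) h * tchar (-\<zeta>) z)) (at z)" for z
    by (intro has_derivative_mult tchar_has_derivative)
       (use CinfD(1)[OF assms(1)] frechet_derivative_works in blast)
  have pd: "pd b ?g = (\<lambda>z. pd b f z * tchar (-\<zeta>) z - ?c * (f z * tchar (-\<zeta>) z))"
    using pd_eq[OF deriv, of b] by (simp add: fun_eq_iff pd_def)
  have cf: "continuous_on S f" "continuous_on S (pd b f)" for S
    using CinfD(2) assms pd_Cinf by blast+
  have "0 = integral cube (pd b ?g)"
  proof (rule integral_cube_pd[symmetric])
    show "?g differentiable at z" for z using deriv differentiable_def by blast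
    show "periodic_fun ?g" using CinfD(3)[OF assms(1)] periodic_tchar[of "-\<zeta>"] assms(3)
      by (simp add: periodic_fun_def)
    show "continuous_on UNIV (pd b ?g)" unfolding pd by (intro continuous_intros cf)
  qed
  also have "\<dots> = fcoef (pd b f) \<zeta> - ?c * fcoef f \<zeta>"
    unfolding pd fcoef_def integral_mult_right[symmetric]
    by (intro integral_diff integrable_continuous continuous_intros cf)
  finally show ?thesis by simp
qed

lemma fcoef_dlist_replicate:
  fixes f :: "'a::euclidean_space \<Rightarrow> complex"
  assumes "f \<in> Cinf_torus" "b \<in> Basis" "\<zeta> \<in> lat"
  shows "fcoef (dlist (replicate m b) f) \<zeta> = (\<i> * of_real (\<zeta> \<bullet> b)) ^ m * fcoef f \<zeta>"
proof (induction m)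
  case (Suc m)
  have "dlist (replicate m b) f \<in> Cinf_torus"
    by (rule dlist_Cinf) (use assms in auto)
  then show ?case using fcoef_pd[of "dlist (replicate m b) f"] assms Suc by simp
qed simp

text \<open>The witness is the direction of the largest coordinate. Being a nonzero integer, that
  coordinate has absolute value at least 1, which absorbs the summand 1.\<close>

lemma lat_one_plus_norm_le:
  fixes \<zeta> :: "'a::euclidean_space"
  assumes "\<zeta> \<in> lat" "\<zeta> \<noteq> 0"
  obtains b where "b \<in> Basis" "1 + norm \<zeta> \<le> (1 + DIM('a)) * \<bar>\<zeta> \<bullet> b\<bar>"
proof -
  have "finite ((\<lambda>b. \<bar>\<zeta> \<bullet> b\<bar>) ` Basis)" "(\<lambda>b. \<bar>\<zeta> \<bullet> b\<bar>) ` Basis \<noteq> {}" by auto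
  then have "Max ((\<lambda>b. \<bar>\<zeta> \<bullet> b\<bar>) ` Basis) \<in> (\<lambda>b. \<bar>\<zeta> \<bullet> b\<bar>) ` Basis" by (rule Max_in)
  then obtain b where b: "b \<in> Basis" "Max ((\<lambda>b. \<bar>\<zeta> \<bullet> b\<bar>) ` Basis) = \<bar>\<zeta> \<bullet> b\<bar>" by (rule imageE)
  have max: "\<bar>\<zeta> \<bullet> c\<bar> \<le> \<bar>\<zeta> \<bullet> b\<bar>" if "c \<in> Basis" for c
    unfolding b(2)[symmetric] using that by (intro Max_ge) auto
  have "norm \<zeta> \<le> (\<Sum>c\<in>Basis. \<bar>\<zeta> \<bullet> c\<bar>)" by (rule norm_le_l1)
  also have "\<dots> \<le> (\<Sum>c\<in>(Basis::'a set). \<bar>\<zeta> \<bullet> b\<bar>)" by (intro sum_mono max)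
  finally have n: "norm \<zeta> \<le> DIM('a) * \<bar>\<zeta> \<bullet> b\<bar>" by simp
  have "\<zeta> \<bullet> b \<noteq> 0"
  proof
    assume "\<zeta> \<bullet> b = 0"
    then have "norm \<zeta> \<le> 0" using n by simp
    then show False using assms by simp
  qed
  moreover have "\<zeta> \<bullet> b \<in> \<int>" using assms b by (simp add: lat_def)
  ultimately have "1 \<le> \<bar>\<zeta> \<bullet> b\<bar>" by (rule Ints_nonzero_abs_ge1[rotated])
  then show ?thesis using n b that by (simp add: distrib_right)
qed

text \<open>Differentiating \<open>m\<close> times in the direction of the largest coordinate of
  \<zeta> gains the full power of the norm. The constant depends on \<open>f\<close> only through
  the bound \<open>M\<close>; this uniformity later makes a functional built from coefficients
  continuous.\<close>

lemma fcoef_decay: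
  fixes f :: "'a::euclidean_space \<Rightarrow> complex"
  assumes f: "f \<in> Cinf_torus"
    and M: "\<And>bs z. set bs \<subseteq> Basis \<Longrightarrow> length bs \<le> m \<Longrightarrow> norm (dlist bs f z) \<le> M"
    and \<zeta>: "\<zeta> \<in> lat"
  shows "norm (fcoef f \<zeta>) * (1 + norm \<zeta>) ^ m \<le> (1 + DIM('a)) ^ m * (M * (2*pi) ^ DIM('a))"
proof (cases "\<zeta> = 0")
  case True
  have "norm (fcoef f \<zeta>) \<le> M * (2*pi) ^ DIM('a)"
    using M[of "[]"] by (intro norm_fcoef_le CinfD f) auto
  moreover have "1 \<le> real ((1 + DIM('a)) ^ m)" by (metis le_add1 of_nat_1 of_nat_mono one_le_power)
  ultimately show ?thesis
    using True mult_mono[of 1 "real ((1 + DIM('a)) ^ m)" "norm (fcoef f \<zeta>)" "M * (2*pi) ^ DIM('a)"] by simp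
next
  case False
  obtain b where b: "b \<in> Basis" "1 + norm \<zeta> \<le> (1 + DIM('a)) * \<bar>\<zeta> \<bullet> b\<bar>"
    by (rule lat_one_plus_norm_le[OF \<zeta> False])
  have "norm (fcoef f \<zeta>) * (1 + norm \<zeta>) ^ m \<le> norm (fcoef f \<zeta>) * ((1 + DIM('a)) * \<bar>\<zeta> \<bullet> b\<bar>) ^ m"
    using b by (intro mult_left_mono power_mono) auto
  also have "\<dots> = (1 + DIM('a)) ^ m * norm (fcoef (dlist (replicate m b) f) \<zeta>)"
    unfolding fcoef_dlist_replicate[OF f b(1) \<zeta>]
    by (simp add: norm_mult norm_power power_mult_distrib)
  also have "\<dots> \<le> (1 + DIM('a)) ^ m * (M * (2*pi) ^ DIM('a))"
  proof (intro mult_left_mono norm_fcoef_le)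
    have "set (replicate m b) \<subseteq> Basis" using b by auto
    then show "continuous_on UNIV (dlist (replicate m b) f)" "norm (dlist (replicate m b) f z) \<le> M" for z
      using M[of "replicate m b" z] CinfD(2)[OF dlist_Cinf[OF f, of "replicate m b"], of UNIV] by simp_all
  qed auto
  finally show ?thesis .
qed

lemma Cinf_dlist_bounded:
  fixes f :: "'a::euclidean_space \<Rightarrow> complex"
  assumes "f \<in> Cinf_torus"
  obtains M where "M > 0" "\<And>bs z. set bs \<subseteq> Basis \<Longrightarrow> length bs \<le> m \<Longrightarrow> norm (dlist bs f z) \<le> M"
proof -
  let ?B = "{bs :: 'a list. set bs \<subseteq> Basis \<and> length bs \<le> m}"
  have "\<exists>M. \<forall>z. norm (dlist bs f z) \<le> M" if "bs \<in> ?B" for bs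
    using that by (metis (no_types, lifting) CinfD(2,3) assms dlist_Cinf mem_Collect_eq periodic_bounded)
  then obtain M where M: "\<And>bs z. bs \<in> ?B \<Longrightarrow> norm (dlist bs f z) \<le> M bs" by metis
  have fin: "finite ?B" by (rule finite_lists_length_le) auto
  have "norm (dlist bs f z) \<le> 1 + (\<Sum>bs\<in>?B. \<bar>M bs\<bar>)" if "bs \<in> ?B" for bs z
  proof -
    have "norm (dlist bs f z) \<le> \<bar>M bs\<bar>" using M[OF that, of z] by linarith
    also have "\<dots> \<le> (\<Sum>bs\<in>?B. \<bar>M bs\<bar>)" using that fin by (intro member_le_sum) auto
    finally show ?thesis by simp
  qed
  moreover have "1 + (\<Sum>bs\<in>?B. \<bar>M bs\<bar>) > 0" by (intro add_pos_nonneg sum_nonneg) auto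
  ultimately show ?thesis using that by blast
qed

lemma rapid_fcoef:
  assumes "f \<in> Cinf_torus"
  shows "rapid (fcoef f)"
  unfolding rapid_def
proof
  fix m
  obtain M where "\<And>bs z. set bs \<subseteq> Basis \<Longrightarrow> length bs \<le> m \<Longrightarrow> norm (dlist bs f z) \<le> M"
    using Cinf_dlist_bounded[OF assms] by metis
  from fcoef_decay[OF assms this]
  show "\<exists>C. \<forall>\<zeta>\<in>lat. norm (fcoef f \<zeta>) * (1 + norm \<zeta>) ^ m \<le> C" by blast
qed

text \<open>The M-test gives uniform convergence on the cube, so sum and integral may be exchanged.
  The pairing is bilinear, without conjugation, so frequency \<zeta> of the series meets frequency
  \<open>-\<zeta>\<close> of \<phi>.\<close>

lemma fun_distr_fseries:
  fixes \<phi> :: "'a::euclidean_space \<Rightarrow> complex"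
  assumes a: "rapid a" and \<phi>: "continuous_on UNIV \<phi>"
  shows "((\<lambda>\<zeta>. a \<zeta> * fcoef \<phi> (-\<zeta>)) has_sum fun_distr (fseries a) \<phi>) lat"
proof -
  have c\<phi>: "continuous_on S \<phi>" for S using \<phi> continuous_on_subset by blast
  have "compact (\<phi> ` cube)" by (intro compact_continuous_image c\<phi>) auto
  then obtain M where M: "\<And>z. z \<in> cube \<Longrightarrow> norm (\<phi> z) \<le> M"
    by (metis bounded_iff compact_imp_bounded imageI)
  have ul: "uniform_limit cube (\<lambda>F z. \<Sum>\<zeta>\<in>F. a \<zeta> * tchar \<zeta> z * \<phi> z) (\<lambda>z. fseries a z * \<phi> z) (finite_subsets_at_top lat)"
  proof (rule Weierstrass_m_test_general')
    show "norm (a \<zeta> * tchar \<zeta> z * \<phi> z) \<le> norm (a \<zeta>) * M" if "z \<in> cube" for \<zeta> z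
      using M[OF that] by (simp add: norm_mult mult_left_mono)
    show "((\<lambda>\<zeta>. a \<zeta> * tchar \<zeta> z * \<phi> z) has_sum fseries a z * \<phi> z) lat" for z
      by (intro has_sum_cmult_left fseries_has_sum a)
    show "(\<lambda>\<zeta>. norm (a \<zeta>) * M) summable_on lat"
      by (intro summable_on_cmult_left rapid_norm_summable a)
  qed
  have "continuous_on cube (\<lambda>z. \<Sum>\<zeta>\<in>F. a \<zeta> * tchar \<zeta> z * \<phi> z)" for F
    by (intro continuous_intros c\<phi>)
  with ul obtain I J where IJ: "\<And>F. ((\<lambda>z. \<Sum>\<zeta>\<in>F. a \<zeta> * tchar \<zeta> z * \<phi> z) has_integral I F) cube"
    "((\<lambda>z. fseries a z * \<phi> z) has_integral J) cube" "(I \<longlongrightarrow> J) (finite_subsets_at_top lat)"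
    by (rule uniform_limit_integral_cbox) auto
  have "I F = (\<Sum>\<zeta>\<in>F. a \<zeta> * fcoef \<phi> (-\<zeta>))" if "F \<subseteq> lat" "finite F" for F
  proof -
    have "I F = (\<Sum>\<zeta>\<in>F. integral cube (\<lambda>z. a \<zeta> * (\<phi> z * tchar \<zeta> z)))"
      using IJ(1)[of F] that
      by (subst integral_sum[symmetric])
         (auto intro!: integrable_continuous continuous_intros c\<phi> simp: integral_unique algebra_simps)
    then show ?thesis by (simp add: fcoef_def)
  qed
  then have "\<forall>\<^sub>F F in finite_subsets_at_top lat. I F = (\<Sum>\<zeta>\<in>F. a \<zeta> * fcoef \<phi> (-\<zeta>))"
    by (intro eventually_finite_subsets_at_top_weakI)
  with IJ(3) have "((\<lambda>\<zeta>. a \<zeta> * fcoef \<phi> (-\<zeta>)) has_sum J) lat"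
    unfolding has_sum_def by (rule Lim_transform_eventually)
  then show ?thesis using IJ(2) by (simp add: fun_distr_def integral_unique)
qed

lemma fcoef_tchar:
  fixes \<zeta> \<eta> :: "'a::euclidean_space"
  assumes "\<zeta> \<in> lat" "\<eta> \<in> lat"
  shows "fcoef (tchar \<zeta>) \<eta> = (if \<zeta> = \<eta> then (2*pi) ^ DIM('a) else 0)"
proof -
  have "fcoef (tchar \<zeta>) \<eta> = integral cube (tchar (\<zeta> + (-\<eta>)))"
    unfolding fcoef_def by (simp only: tchar_add_left[symmetric])
  then show ?thesis
    using integral_cube_tchar[of "\<zeta> + (-\<eta>)"] assms by (simp add: lat_add del: add_uminus_conv_diff)
       (simp add: add_eq_0_iff2)
qed

lemma fcoef_eq_fun_distr: "fcoef f \<zeta> = fun_distr f (tchar (-\<zeta>))"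
  by (simp add: fcoef_def fun_distr_def)

lemma fcoef_fseries:
  fixes a :: "'a::euclidean_space \<Rightarrow> complex"
  assumes "rapid a" "\<zeta> \<in> lat"
  shows "fcoef (fseries a) \<zeta> = (2*pi) ^ DIM('a) * a \<zeta>"
proof -
  have "((\<lambda>\<eta>. a \<eta> * fcoef (tchar (-\<zeta>)) (-\<eta>)) has_sum fcoef (fseries a) \<zeta>) lat"
    unfolding fcoef_eq_fun_distr[of "fseries a"]
    by (intro fun_distr_fseries assms continuous_intros)
  moreover have "((\<lambda>\<eta>. a \<eta> * fcoef (tchar (-\<zeta>)) (-\<eta>)) has_sum (2*pi) ^ DIM('a) * a \<zeta>) lat"
  proof (rule has_sum_finite_neutralI[of "{\<zeta>}"])
    show "a \<eta> * fcoef (tchar (-\<zeta>)) (-\<eta>) = 0" if "\<eta> \<in> lat - {\<zeta>}" for \<eta>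
      using that assms by (auto simp: fcoef_tchar)
  qed (use assms in \<open>auto simp: fcoef_tchar\<close>)
  ultimately show ?thesis by (rule has_sum_unique)
qed

section \<open>Fourier inversion\<close>

text \<open>An inductive closure spares the bookkeeping of finite frequency sets; closure under
  products follows by a double induction.\<close>

inductive trig_poly :: "('a::euclidean_space \<Rightarrow> complex) \<Rightarrow> bool" where
  trig_poly_tchar: "\<zeta> \<in> lat \<Longrightarrow> trig_poly (tchar \<zeta>)"
| trig_poly_cmult: "trig_poly f \<Longrightarrow> trig_poly (\<lambda>z. c * f z)"
| trig_poly_add: "trig_poly f \<Longrightarrow> trig_poly g \<Longrightarrow> trig_poly (\<lambda>z. f z + g z)"

lemma trig_poly_mult:
  assumes "trig_poly f" "trig_poly g"
  shows "trig_poly (\<lambda>z. f z * g z)"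
  using assms(1)
proof (induction f rule: trig_poly.induct)
  case (trig_poly_tchar \<zeta>)
  show ?case
    using assms(2)
  proof (induction g rule: trig_poly.induct)
    case (trig_poly_tchar \<eta>)
    then have "trig_poly (tchar (\<zeta> + \<eta>))"
      using \<open>\<zeta> \<in> lat\<close> by (intro trig_poly.trig_poly_tchar lat_add)
    moreover have "tchar (\<zeta> + \<eta>) = (\<lambda>z. tchar \<zeta> z * tchar \<eta> z)"
      by (rule ext) (rule tchar_add_left)
    ultimately show ?case by simp
  next
    case (trig_poly_cmult g c)
    from trig_poly.trig_poly_cmult[OF trig_poly_cmult.IH, of c] show ?case
      by (simp add: mult.left_commute)
  next
    case (trig_poly_add g h)
    from trig_poly.trig_poly_add[OF trig_poly_add.IH] show ?case by (simp add: distrib_left)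
  qed
next
  case (trig_poly_cmult f c)
  from trig_poly.trig_poly_cmult[OF trig_poly_cmult.IH, of c] show ?case
    by (simp add: mult.assoc)
next
  case (trig_poly_add f h)
  from trig_poly.trig_poly_add[OF trig_poly_add.IH] show ?case by (simp add: distrib_right)
qed

lemma trig_poly_const: "trig_poly (\<lambda>z. c)"
  using trig_poly_cmult[OF trig_poly_tchar[OF lat_zero], of c] by simp

lemma trig_poly_sum: "finite A \<Longrightarrow> (\<And>i. i \<in> A \<Longrightarrow> trig_poly (f i)) \<Longrightarrow> trig_poly (\<lambda>z. \<Sum>i\<in>A. f i z)"
  by (induction A rule: finite_induct) (auto intro: trig_poly_const trig_poly_add)

lemma trig_poly_cos_sin:
  assumes "b \<in> Basis"
  shows "trig_poly (\<lambda>z. of_real (cos (b \<bullet> z)))" "trig_poly (\<lambda>z. of_real (sin (b \<bullet> z)))"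
proof -
  have t: "trig_poly (tchar b)" "trig_poly (tchar (-b))"
    using lat_Basis[OF assms] by (simp_all add: trig_poly_tchar)
  have "of_real (cos (b \<bullet> z)) = (1/2) * tchar b z + (1/2) * tchar (-b) z" for z
    by (simp add: tchar_def complex_eq_iff)
  then show "trig_poly (\<lambda>z. of_real (cos (b \<bullet> z)))"
    by (simp only:) (intro trig_poly_add trig_poly_cmult t)
  have "of_real (sin (b \<bullet> z)) = (- \<i>/2) * tchar b z + (\<i>/2) * tchar (-b) z" for z
    by (simp add: tchar_def complex_eq_iff)
  then show "trig_poly (\<lambda>z. of_real (sin (b \<bullet> z)))"
    by (simp only:) (intro trig_poly_add trig_poly_cmult t)
qed

text \<open>The image of the torus under \<open>circ\<close> is a product of circles; it serves as the Hausdorff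
  quotient of the cube by the identification of opposite faces.\<close>
definition circ :: "'a::euclidean_space \<Rightarrow> 'a \<times> 'a" where
  "circ z = ((\<Sum>b\<in>Basis. cos (b \<bullet> z) *\<^sub>R b), (\<Sum>b\<in>Basis. sin (b \<bullet> z) *\<^sub>R b))"

lemma continuous_on_circ: "continuous_on S circ"
  unfolding circ_def by (intro continuous_intros)

lemma circ_eq_imp:
  fixes z w :: "'a::euclidean_space"
  assumes "circ z = circ w" "periodic_fun f"
  shows "f z = f w"
proof -
  have "\<exists>n::int. b \<bullet> z = b \<bullet> w + 2 * pi * n" if b: "b \<in> Basis" for b
  proof -
    have "fst (circ z) \<bullet> b = fst (circ w) \<bullet> b" "snd (circ z) \<bullet> b = snd (circ w) \<bullet> b"
      using assms by simp_all
    then show ?thesis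
      using b sin_cos_eq_iff[of "b \<bullet> z" "b \<bullet> w"] by (simp add: circ_def)
  qed
  then obtain n :: "'a \<Rightarrow> int" where n: "\<And>b. b \<in> Basis \<Longrightarrow> b \<bullet> z = b \<bullet> w + 2 * pi * n b" by metis
  define \<zeta> where "\<zeta> = (\<Sum>b\<in>Basis. of_int (n b) *\<^sub>R b)"
  have \<zeta>b: "\<zeta> \<bullet> b = of_int (n b)" if "b \<in> Basis" for b
    using that by (simp add: \<zeta>_def)
  have "\<zeta> \<in> lat" by (simp add: lat_def \<zeta>b)
  moreover have "z = w + (2*pi) *\<^sub>R \<zeta>"
    by (rule euclidean_eqI) (use n \<zeta>b in \<open>simp add: inner_add_right inner_commute\<close>)
  ultimately show ?thesis using periodic_lat[OF assms(2)] by blast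
qed

text \<open>A linear function of \<open>circ z\<close> is a combination of the sines and cosines of
  the coordinates. Closure under sums and products handles all other polynomials.\<close>

lemma trig_poly_real_polynomial:
  assumes "real_polynomial_function p"
  shows "trig_poly (\<lambda>z::'a::euclidean_space. of_real (p (circ z)))"
  using assms
proof (induction p rule: real_polynomial_function.induct)
  case (linear f)
  interpret f: bounded_linear f by fact
  have "f (circ z) = (\<Sum>b\<in>Basis. cos (b \<bullet> z) * f (b, 0) + sin (b \<bullet> z) * f (0, b))" for z :: 'a
  proof -
    have circ: "circ z = (\<Sum>b\<in>Basis. cos (b \<bullet> z) *\<^sub>R (b, 0) + sin (b \<bullet> z) *\<^sub>R (0, b))"
      by (simp add: circ_def sum_prod sum.distrib prod_eq_iff fst_sum snd_sum)
    show ?thesis unfolding circ by (simp only: f.sum f.add f.scaleR real_scaleR_def)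
  qed
  then have "(\<lambda>z::'a. complex_of_real (f (circ z))) = (\<lambda>z. \<Sum>b\<in>Basis. of_real (f (b, 0)) * of_real (cos (b \<bullet> z))
      + of_real (f (0, b)) * of_real (sin (b \<bullet> z)))"
    by (simp add: mult.commute)
  then show ?case
    by (simp only:) (intro trig_poly_sum trig_poly_add trig_poly_cmult trig_poly_cos_sin finite_Basis)
next
  case (add f g)
  from trig_poly_add[OF add.IH] show ?case by simp
next
  case (mult f g)
  from trig_poly_mult[OF mult.IH] show ?case by simp
qed (rule trig_poly_const)

text \<open>Continuity is proved in the same induction because splitting the integral of a sum
  requires integrability of both parts.\<close>

lemma integral_mult_trig_poly:
  assumes "trig_poly f" and h: "continuous_on UNIV h" "\<And>\<zeta>. \<zeta> \<in> lat \<Longrightarrow> fcoef h \<zeta> = 0"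
  shows "continuous_on UNIV f \<and> integral cube (\<lambda>z. h z * f z) = 0"
  using assms(1)
proof (induction f rule: trig_poly.induct)
  case (trig_poly_tchar \<zeta>)
  then show ?case using h(2)[of "-\<zeta>"] by (auto simp: fcoef_def intro!: continuous_intros)
next
  case (trig_poly_cmult f c)
  then have "integral cube (\<lambda>z. h z * (c * f z)) = c * integral cube (\<lambda>z. h z * f z)"
    by (simp add: mult.left_commute)
  with trig_poly_cmult show ?case by (auto intro!: continuous_intros)
next
  case (trig_poly_add f g)
  have c: "continuous_on cube h" "continuous_on cube f" "continuous_on cube g"
    using trig_poly_add h(1) continuous_on_subset by blast+
  have "integral cube (\<lambda>z. h z * f z + h z * g z) = integral cube (\<lambda>z. h z * f z) + integral cube (\<lambda>z. h z * g z)"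
    by (intro integral_add integrable_continuous continuous_intros c)
  with trig_poly_add show ?case by (auto intro!: continuous_intros simp: distrib_left)
qed

text \<open>Stone-Weierstrass is applied on the compact image of \<open>circ\<close>:
  \<open>h\<close> descends to a continuous function there, and polynomials pull back to
  trigonometric polynomials. Real and imaginary parts are approximated separately.\<close>

lemma trig_poly_approx:
  fixes h :: "'a::euclidean_space \<Rightarrow> complex"
  assumes h: "continuous_on UNIV h" "periodic_fun h" and e: "e > 0"
  obtains p where "trig_poly p" "\<And>z. z \<in> cube \<Longrightarrow> norm (h z - p z) < e"
proof -
  let ?K = "circ ` cube :: ('a \<times> 'a) set"
  have K: "compact ?K" by (intro compact_continuous_image continuous_on_circ) auto
  \<comment> \<open>Any preimage in the cube may be chosen: points with the same \<open>circ\<close>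
    value differ by a lattice period, so \<open>h\<close> agrees on them.\<close>
  define g where "g = (\<lambda>y. h (SOME z. z \<in> cube \<and> circ z = y))"
  have g: "g (circ z) = h z" if "z \<in> cube" for z
  proof -
    let ?w = "SOME w. w \<in> cube \<and> circ w = circ z"
    have "?w \<in> cube \<and> circ ?w = circ z" by (rule someI[of _ z]) (use that in auto)
    then show ?thesis using circ_eq_imp[OF _ h(2), of ?w z] by (simp add: g_def)
  qed
  \<comment> \<open>The cube is compact, so \<open>circ\<close> maps its closed subsets to closed
    sets and behaves as a quotient map; preimages of closed sets under \<open>g\<close> are
    therefore closed.\<close>
  have cg: "continuous_on ?K g"
    unfolding continuous_on_closed_vimage[OF compact_imp_closed[OF K]]
  proof (intro allI impI)
    fix B :: "complex set" assume "closed B"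
    have "closed (h -` B \<inter> cube)"
      using continuous_on_subset[OF h(1) subset_UNIV, of cube] \<open>closed B\<close>
      by (simp add: continuous_on_closed_vimage[OF closed_cbox])
    moreover have "bounded (h -` B \<inter> cube)" by (rule bounded_subset[OF bounded_cbox]) auto
    ultimately have "compact (h -` B \<inter> cube)" by (simp add: compact_eq_bounded_closed)
    then have "closed (circ ` (h -` B \<inter> cube))"
      using compact_imp_closed compact_continuous_image[OF continuous_on_circ] by blast
    also have "circ ` (h -` B \<inter> cube) = g -` B \<inter> ?K" by (auto simp: g)
    finally show "closed (g -` B \<inter> ?K)" .
  qed
  have cRe: "continuous_on ?K (\<lambda>y. Re (g y))" and cIm: "continuous_on ?K (\<lambda>y. Im (g y))"
    by (intro continuous_intros cg)+
  from e have e2: "e / 2 > 0" by simp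
  obtain p where p: "real_polynomial_function p" "\<And>y. y \<in> ?K \<Longrightarrow> \<bar>Re (g y) - p y\<bar> < e / 2"
    using Stone_Weierstrass_real_polynomial_function[OF K cRe e2] by blast
  obtain q where q: "real_polynomial_function q" "\<And>y. y \<in> ?K \<Longrightarrow> \<bar>Im (g y) - q y\<bar> < e / 2"
    using Stone_Weierstrass_real_polynomial_function[OF K cIm e2] by blast
  show ?thesis
  proof
    show "trig_poly (\<lambda>z. of_real (p (circ z)) + \<i> * of_real (q (circ z)))"
      by (intro trig_poly_add trig_poly_cmult trig_poly_real_polynomial p q)
    fix z :: 'a assume z: "z \<in> cube"
    let ?d = "h z - (of_real (p (circ z)) + \<i> * of_real (q (circ z)))"
    have "norm ?d \<le> \<bar>Re ?d\<bar> + \<bar>Im ?d\<bar>" by (rule cmod_le)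
    also have "\<dots> < e / 2 + e / 2"
      using p(2)[of "circ z"] q(2)[of "circ z"] z by (intro add_strict_mono) (auto simp: g)
    finally show "norm ?d < e" by simp
  qed
qed

text \<open>Such an \<open>h\<close> integrates to zero against every trigonometric polynomial.
  Approximating \<open>cnj h\<close> uniformly by these makes the integral of the squared modulus of
  \<open>h\<close> arbitrarily small, and a continuous nonnegative function with zero integral
  vanishes.\<close>

lemma fcoef_eq_0_imp_eq_0:
  fixes h :: "'a::euclidean_space \<Rightarrow> complex"
  assumes h: "continuous_on UNIV h" "periodic_fun h" and 0: "\<And>\<zeta>. \<zeta> \<in> lat \<Longrightarrow> fcoef h \<zeta> = 0"
  shows "h z = 0"
proof -
  have ch: "continuous_on S h" for S using h(1) continuous_on_subset by blast
  obtain M where M: "\<And>z. norm (h z) \<le> M" using periodic_bounded[OF h] by blast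
  have M0: "0 \<le> M" using M[of 0] norm_ge_zero order_trans by blast
  let ?V = "(2*pi) ^ DIM('a)"
  have small: "norm (integral cube (\<lambda>z. h z * cnj (h z))) \<le> M * e * ?V" if e: "e > 0" for e
  proof -
    have "continuous_on UNIV (\<lambda>z. cnj (h z))" by (intro continuous_intros ch)
    moreover have "periodic_fun (\<lambda>z. cnj (h z))" using h(2) by (simp add: periodic_fun_def)
    ultimately obtain p where p: "trig_poly p" "\<And>z. z \<in> cube \<Longrightarrow> norm (cnj (h z) - p z) < e"
      using trig_poly_approx e by blast
    have ip: "continuous_on UNIV p" "integral cube (\<lambda>z. h z * p z) = 0"
      using integral_mult_trig_poly[OF p(1) h(1) 0] by auto
    then have cp: "continuous_on S p" for S using continuous_on_subset by blast
    have "integral cube (\<lambda>z. h z * (cnj (h z) - p z)) = integral cube (\<lambda>z. h z * cnj (h z)) - integral cube (\<lambda>z. h z * p z)"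
      unfolding right_diff_distrib by (intro integral_diff integrable_continuous continuous_intros ch cp)
    then have "integral cube (\<lambda>z. h z * cnj (h z)) = integral cube (\<lambda>z. h z * (cnj (h z) - p z))"
      using ip by simp
    moreover have "norm (integral cube (\<lambda>z. h z * (cnj (h z) - p z))) \<le> (M * e) * measure lborel (cube :: 'a set)"
    proof (rule integrable_bound)
      show "0 \<le> M * e" using M0 e by simp
      show "(\<lambda>z. h z * (cnj (h z) - p z)) integrable_on cube"
        by (intro integrable_continuous continuous_intros ch cp)
      show "norm (h z * (cnj (h z) - p z)) \<le> M * e" if "z \<in> cube" for z
        unfolding norm_mult using M p(2)[OF that] M0 by (intro mult_mono) auto
    qed
    ultimately show ?thesis by (simp add: measure_cube)
  qed
  have "norm (integral cube (\<lambda>z. h z * cnj (h z))) \<le> 0"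
  proof (rule field_le_epsilon)
    fix e :: real assume "e > 0"
    have V: "?V > 0" by simp
    \<comment> \<open>Dividing by \<open>M + 1\<close> instead of \<open>M\<close> keeps the
      tolerance well defined when \<open>M = 0\<close>.\<close>
    have "norm (integral cube (\<lambda>z. h z * cnj (h z))) \<le> M * (e / ((M + 1) * ?V)) * ?V"
      using M0 V \<open>e > 0\<close> by (intro small divide_pos_pos mult_pos_pos) auto
    also have "\<dots> = M / (M + 1) * e" using V by simp
    also have "\<dots> \<le> 1 * e" using M0 \<open>e > 0\<close> by (intro mult_right_mono) auto
    finally show "norm (integral cube (\<lambda>z. h z * cnj (h z))) \<le> 0 + e" by simp
  qed
  then have "integral cube (\<lambda>z. h z * cnj (h z)) = 0" by simp
  then have "integral cube (\<lambda>z. complex_of_real ((norm (h z))^2)) = 0"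
    by (simp only: complex_norm_square)
  moreover have "integral cube (\<lambda>z. complex_of_real ((norm (h z))^2)) = of_real (integral cube (\<lambda>z. (norm (h z))^2))"
    by (rule integral_unique) (intro has_integral_of_real integrable_integral integrable_continuous continuous_intros ch)
  ultimately have "integral cube (\<lambda>z. (norm (h z))^2) = 0" by (simp only: of_real_eq_0_iff)
  moreover have "box 0 ((2*pi) *\<^sub>R One) \<noteq> ({} :: 'a set)" by (simp add: box_ne_empty)
  moreover have "continuous_on cube (\<lambda>z. (norm (h z))^2)" by (intro continuous_intros ch)
  ultimately have cube0: "\<forall>z\<in>cube. (norm (h z))^2 = 0"
    using integral_cbox_eq_0_iff[of 0 "(2*pi) *\<^sub>R (One :: 'a)" "\<lambda>z. (norm (h z))^2"] by simp
  obtain \<zeta> where "\<zeta> \<in> lat" "z + (2*pi) *\<^sub>R \<zeta> \<in> cube" by (rule lat_cube_reduce)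
  then show ?thesis using cube0 periodic_lat[OF h(2), of \<zeta> z] by simp
qed

lemma fcoef_diff:
  fixes f g :: "'a::euclidean_space \<Rightarrow> complex"
  assumes "continuous_on UNIV f" "continuous_on UNIV g"
  shows "fcoef (\<lambda>z. f z - g z) \<zeta> = fcoef f \<zeta> - fcoef g \<zeta>"
proof -
  have "continuous_on cube f" "continuous_on cube g"
    using assms continuous_on_subset by blast+
  then show ?thesis
    unfolding fcoef_def left_diff_distrib by (intro integral_diff integrable_continuous continuous_intros)
qed

text \<open>Both sides are continuous and periodic with the same coefficients, so uniqueness applies
  to their difference.\<close>

lemma fourier_inversion:
  fixes f :: "'a::euclidean_space \<Rightarrow> complex"
  assumes "f \<in> Cinf_torus"
  shows "f = fseries (\<lambda>\<zeta>. fcoef f \<zeta> / (2*pi) ^ DIM('a))"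
    and "rapid (\<lambda>\<zeta>. fcoef f \<zeta> / (2*pi) ^ DIM('a))"
proof -
  let ?a = "\<lambda>\<zeta>. fcoef f \<zeta> / (2*pi) ^ DIM('a)"
  show r: "rapid ?a"
    by (rule rapid_dominated[OF rapid_fcoef[OF assms], of _ "1 / (2*pi) ^ DIM('a)" 0])
       (simp add: norm_divide norm_power norm_mult)
  show "f = fseries ?a"
  proof
    fix z
    have "f z - fseries ?a z = 0"
    proof (rule fcoef_eq_0_imp_eq_0[where h = "\<lambda>z. f z - fseries ?a z"])
      show "continuous_on UNIV (\<lambda>z. f z - fseries ?a z)"
        by (intro continuous_intros CinfD assms continuous_on_fseries r)
      show "periodic_fun (\<lambda>z. f z - fseries ?a z)"
        using CinfD(3)[OF assms] periodic_fseries[of ?a] by (simp add: periodic_fun_def)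
      show "fcoef (\<lambda>z. f z - fseries ?a z) \<zeta> = 0" if "\<zeta> \<in> lat" for \<zeta>
      proof -
        have "fcoef (\<lambda>z. f z - fseries ?a z) \<zeta> = fcoef f \<zeta> - fcoef (fseries ?a) \<zeta>"
          by (intro fcoef_diff CinfD assms continuous_on_fseries r)
        also have "\<dots> = 0" unfolding fcoef_fseries[OF r that] by simp
        finally show ?thesis .
      qed
    qed
    then show "f z = fseries ?a z" by simp
  qed
qed

section \<open>Fourier expansion of distributions\<close>

lemma rapid_add:
  assumes "rapid a" "rapid b" shows "rapid (\<lambda>\<zeta>. a \<zeta> + b \<zeta>)"
  unfolding rapid_def
proof
  fix m
  obtain C D where C: "\<And>\<zeta>. \<zeta> \<in> lat \<Longrightarrow> norm (a \<zeta>) * (1 + norm \<zeta>) ^ m \<le> C"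
    and D: "\<And>\<zeta>. \<zeta> \<in> lat \<Longrightarrow> norm (b \<zeta>) * (1 + norm \<zeta>) ^ m \<le> D"
    using assms unfolding rapid_def by metis
  have "norm (a \<zeta> + b \<zeta>) * (1 + norm \<zeta>) ^ m \<le> C + D" if "\<zeta> \<in> lat" for \<zeta>
  proof -
    have "norm (a \<zeta> + b \<zeta>) * (1 + norm \<zeta>) ^ m \<le> (norm (a \<zeta>) + norm (b \<zeta>)) * (1 + norm \<zeta>) ^ m"
      by (intro mult_right_mono norm_triangle_ineq) auto
    then show ?thesis using C[OF that] D[OF that] by (simp add: distrib_right)
  qed
  then show "\<exists>C. \<forall>\<zeta>\<in>lat. norm (a \<zeta> + b \<zeta>) * (1 + norm \<zeta>) ^ m \<le> C" by blast
qed

lemma rapid_uminus_arg: "rapid a \<Longrightarrow> rapid (\<lambda>\<zeta>. a (-\<zeta>))"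
  unfolding rapid_def by (metis lat_uminus norm_minus_cancel)

lemma rapid_restrict: "rapid a \<Longrightarrow> rapid (\<lambda>\<zeta>. if \<zeta> \<in> S then a \<zeta> else 0)"
  by (rule rapid_dominated[of a _ 1 0]) auto

text \<open>Each such point contributes at least the fixed positive amount \<open>?e\<close> to a
  convergent sum of positive terms, which bounds the number of points. The absolute value of
  \<open>R\<close> keeps \<open>?e\<close> positive for negative \<open>R\<close>.\<close>

lemma finite_lat_norm_le: "finite {\<zeta> \<in> lat :: 'a::euclidean_space set. norm \<zeta> \<le> R}"
proof -
  let ?w = "\<lambda>\<zeta>::'a. 1 / (1 + norm \<zeta>) ^ (2 * DIM('a))"
  let ?e = "1 / (1 + \<bar>R\<bar>) ^ (2 * DIM('a))"
  let ?S = "\<Sum>\<^sub>\<infinity>\<zeta>\<in>lat. ?w \<zeta>"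
  have "card F \<le> nat \<lceil>?S / ?e\<rceil>" if F: "F \<subseteq> {\<zeta> \<in> lat. norm \<zeta> \<le> R}" "finite F" for F :: "'a set"
  proof -
  have e: "?e > 0" by (intro divide_pos_pos zero_less_power) auto
  have "of_nat (card F) * ?e \<le> sum ?w F"
  proof (rule sum_bounded_below)
    fix \<zeta> assume "\<zeta> \<in> F"
    then show "?e \<le> ?w \<zeta>" using F
      by (intro divide_left_mono power_mono mult_pos_pos zero_less_power) (auto intro: add_pos_nonneg)
  qed
  also have "\<dots> \<le> ?S" using F by (intro finite_sum_le_infsum summable_on_lat) auto
  finally have "real (card F) \<le> ?S / ?e" by (subst pos_le_divide_eq[OF e])
  then show ?thesis by linarith
  qed
  then show ?thesis
    by (intro finite_if_finite_subsets_card_bdd[THEN conjunct1]) blast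
qed

lemma distribution_add:
  "distribution u \<Longrightarrow> f \<in> Cinf_torus \<Longrightarrow> g \<in> Cinf_torus \<Longrightarrow> u (\<lambda>z. f z + g z) = u f + u g"
  by (simp add: distribution_def)

lemma distribution_cmult:
  "distribution u \<Longrightarrow> f \<in> Cinf_torus \<Longrightarrow> u (\<lambda>z. c * f z) = c * u f"
  by (simp add: distribution_def)

lemma Cinf_sum_tchar:
  assumes "finite F" "F \<subseteq> lat"
  shows "(\<lambda>z. \<Sum>\<zeta>\<in>F. a \<zeta> * tchar \<zeta> z) \<in> Cinf_torus"
  using fseries_Cinf[OF rapid_finite_support, of "\<lambda>\<zeta>. if \<zeta> \<in> F then a \<zeta> else 0"]
  by (simp add: fseries_finite[OF assms, abs_def] assms)

lemma distribution_sum_tchar: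
  assumes u: "distribution u" and F: "finite F" "F \<subseteq> lat"
  shows "u (\<lambda>z. \<Sum>\<zeta>\<in>F. a \<zeta> * tchar \<zeta> z) = (\<Sum>\<zeta>\<in>F. a \<zeta> * u (tchar \<zeta>))"
  using F
proof (induction F rule: finite_induct)
  case empty
  have "u (\<lambda>z. 0 * tchar 0 z) = 0 * u (tchar 0)"
    by (rule distribution_cmult[OF u tchar_Cinf[OF lat_zero]])
  then show ?case by simp
next
  case (insert \<eta> F)
  have F: "(\<lambda>z. \<Sum>\<zeta>\<in>F. a \<zeta> * tchar \<zeta> z) \<in> Cinf_torus" using insert by (intro Cinf_sum_tchar) auto
  have \<eta>: "tchar \<eta> \<in> Cinf_torus" using insert by (intro tchar_Cinf) auto
  have "u (\<lambda>z. a \<eta> * tchar \<eta> z + (\<Sum>\<zeta>\<in>F. a \<zeta> * tchar \<zeta> z))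
      = u (\<lambda>z. a \<eta> * tchar \<eta> z) + u (\<lambda>z. \<Sum>\<zeta>\<in>F. a \<zeta> * tchar \<zeta> z)"
    by (rule distribution_add[OF u Cinf_cmult[OF \<eta>] F])
  moreover have "u (\<lambda>z. a \<eta> * tchar \<eta> z) = a \<eta> * u (tchar \<eta>)"
    by (rule distribution_cmult[OF u \<eta>])
  ultimately show ?case using insert by simp
qed

text \<open>The definition speaks only of test functions with seminorms at most 1; rescaling by
  \<open>1 / e\<close> gives a homogeneous estimate. Since \<open>e\<close> must be positive, a
  seminorm bound that might be zero is used with some slack.\<close>

lemma distribution_bound:
  fixes u :: "('a::euclidean_space \<Rightarrow> complex) \<Rightarrow> complex"
  assumes "distribution u"
  obtains C k where "C > 0" "\<And>\<phi> e. \<phi> \<in> Cinf_torus \<Longrightarrow> e > 0 \<Longrightarrow>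
    (\<And>bs z. set bs \<subseteq> Basis \<Longrightarrow> length bs \<le> k \<Longrightarrow> norm (dlist bs \<phi> z) \<le> e) \<Longrightarrow> norm (u \<phi>) \<le> C * e"
proof -
  obtain C k where C: "\<And>\<phi>. \<phi> \<in> Cinf_torus \<Longrightarrow>
      (\<forall>bs z. set bs \<subseteq> Basis \<and> length bs \<le> k \<longrightarrow> norm (dlist bs \<phi> z) \<le> 1) \<Longrightarrow> norm (u \<phi>) \<le> C"
    using assms unfolding distribution_def by metis
  show thesis
  proof (rule that[of "\<bar>C\<bar> + 1" k])
    fix \<phi> :: "'a \<Rightarrow> complex" and e :: real
    assume \<phi>: "\<phi> \<in> Cinf_torus" and e: "e > 0"
      and b: "\<And>bs z. set bs \<subseteq> Basis \<Longrightarrow> length bs \<le> k \<Longrightarrow> norm (dlist bs \<phi> z) \<le> e"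
    let ?c = "complex_of_real (1 / e)"
    have "norm (u (\<lambda>z. ?c * \<phi> z)) \<le> C"
    proof (rule C)
      show "\<forall>bs z. set bs \<subseteq> Basis \<and> length bs \<le> k \<longrightarrow> norm (dlist bs (\<lambda>z. ?c * \<phi> z) z) \<le> 1"
      proof (intro allI impI)
        fix bs z assume bs: "set bs \<subseteq> (Basis :: 'a set) \<and> length bs \<le> k"
        then show "norm (dlist bs (\<lambda>z. ?c * \<phi> z) z) \<le> 1"
          using b[of bs z] e dlist_cmult[OF \<phi>, of bs ?c] by (simp add: norm_mult norm_divide)
      qed
    qed (rule Cinf_cmult[OF \<phi>])
    moreover have "u (\<lambda>z. ?c * \<phi> z) = ?c * u \<phi>"
      by (rule distribution_cmult[OF assms \<phi>])
    ultimately have "norm (u \<phi>) \<le> C * e" using e by (simp add: norm_mult norm_divide divide_le_eq)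
    also have "\<dots> \<le> (\<bar>C\<bar> + 1) * e" using e by (intro mult_right_mono) auto
    finally show "norm (u \<phi>) \<le> (\<bar>C\<bar> + 1) * e" .
  qed auto
qed

lemma norm_prod_list_inner_le:
  "set bs \<subseteq> Basis \<Longrightarrow> norm (\<Prod>b\<leftarrow>bs. \<i> * complex_of_real (\<zeta> \<bullet> b)) \<le> (1 + norm \<zeta>) ^ length bs"
proof (induction bs)
  case (Cons b bs)
  have "\<bar>\<zeta> \<bullet> b\<bar> \<le> 1 + norm \<zeta>" using Cons.prems Basis_le_norm[of b \<zeta>] by simp
  then show ?case using Cons by (simp add: norm_mult mult_mono)
qed simp

text \<open>Finite partial sums are handled by linearity. The tail is again a rapid series, and all
  its derivatives up to the order \<open>k\<close> of \<open>u\<close> are dominated by the tail of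
  the convergent sum of \<open>g\<close>, so continuity makes its contribution vanish.\<close>

lemma distribution_fseries:
  fixes u :: "('a::euclidean_space \<Rightarrow> complex) \<Rightarrow> complex"
  assumes u: "distribution u" and a: "rapid a"
  shows "((\<lambda>\<zeta>. a \<zeta> * u (tchar \<zeta>)) has_sum u (fseries a)) lat"
proof -
  obtain C k where C: "C > 0" "\<And>\<phi> e. \<phi> \<in> Cinf_torus \<Longrightarrow> e > 0 \<Longrightarrow>
    (\<And>bs z. set bs \<subseteq> Basis \<Longrightarrow> length bs \<le> k \<Longrightarrow> norm (dlist bs \<phi> z) \<le> e) \<Longrightarrow> norm (u \<phi>) \<le> C * e"
    using distribution_bound[OF u] by blast
  define g where "g = (\<lambda>\<zeta>. norm (a \<zeta>) * (1 + norm \<zeta>) ^ k)"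
  define S where "S = infsum g lat"
  have g: "(g has_sum S) lat" unfolding S_def g_def by (intro has_sum_infsum rapid_summable a)
  have tail: "norm (u (fseries a) - (\<Sum>\<zeta>\<in>F. a \<zeta> * u (tchar \<zeta>))) \<le> C * (S - sum g F + e)"
    if F: "finite F" "F \<subseteq> lat" and e: "e > 0" for F :: "'a set" and e :: real
  proof -
    let ?a = "\<lambda>\<zeta>. if \<zeta> \<in> - F then a \<zeta> else 0"
    have ra: "rapid ?a" by (rule rapid_restrict[OF a])
    have "fseries a z = (\<Sum>\<zeta>\<in>F. a \<zeta> * tchar \<zeta> z) + fseries ?a z" for z
    proof -
      have "rapid (\<lambda>\<zeta>. if \<zeta> \<in> F then a \<zeta> else 0)" by (rule rapid_restrict[OF a])
      then have "((\<lambda>\<zeta>. (if \<zeta> \<in> F then a \<zeta> else 0) * tchar \<zeta> z + ?a \<zeta> * tchar \<zeta> z) has_sum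
          (\<Sum>\<zeta>\<in>F. a \<zeta> * tchar \<zeta> z) + fseries ?a z) lat"
        unfolding fseries_finite[OF F, symmetric] by (intro has_sum_add fseries_has_sum ra)
      moreover have "(\<lambda>\<zeta>. (if \<zeta> \<in> F then a \<zeta> else 0) * tchar \<zeta> z + ?a \<zeta> * tchar \<zeta> z) = (\<lambda>\<zeta>. a \<zeta> * tchar \<zeta> z)"
        by auto
      ultimately show ?thesis using has_sum_unique[OF fseries_has_sum[OF a, of z]] by simp
    qed
    then have "fseries a = (\<lambda>z. (\<Sum>\<zeta>\<in>F. a \<zeta> * tchar \<zeta> z) + fseries ?a z)" by (rule ext)
    moreover have "u (\<lambda>z. (\<Sum>\<zeta>\<in>F. a \<zeta> * tchar \<zeta> z) + fseries ?a z) =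
        u (\<lambda>z. \<Sum>\<zeta>\<in>F. a \<zeta> * tchar \<zeta> z) + u (fseries ?a)"
      by (rule distribution_add[OF u Cinf_sum_tchar[OF F] fseries_Cinf[OF ra]])
    ultimately have "u (fseries a) - (\<Sum>\<zeta>\<in>F. a \<zeta> * u (tchar \<zeta>)) = u (fseries ?a)"
      using distribution_sum_tchar[OF u F, of a] by simp
    moreover have g': "((\<lambda>\<zeta>. if \<zeta> \<in> - F then g \<zeta> else 0) has_sum (S - sum g F)) lat"
    proof -
      have "((\<lambda>\<zeta>. if \<zeta> \<in> - F then g \<zeta> else 0) has_sum (S - sum g F)) (lat - F)
        \<longleftrightarrow> (g has_sum (S - sum g F)) (lat - F)"
        by (rule has_sum_cong) auto
      also have "\<dots>" using F by (intro has_sum_Diff g has_sum_finite)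
      finally show ?thesis
        by (subst has_sum_cong_neutral[where S = lat and T = "lat - F" and g = "\<lambda>\<zeta>. if \<zeta> \<in> - F then g \<zeta> else 0"]) auto
    qed
    have "norm (u (fseries ?a)) \<le> C * (S - sum g F + e)"
    proof (rule C(2))
      show "fseries ?a \<in> Cinf_torus" by (rule fseries_Cinf[OF ra])
      have "0 \<le> S - sum g F" by (rule has_sum_nonneg[OF g']) (auto simp: g_def)
      then show "S - sum g F + e > 0" using e by simp
      fix bs :: "'a list" and z assume bs: "set bs \<subseteq> Basis" "length bs \<le> k"
      let ?b = "\<lambda>\<zeta>. (\<Prod>b\<leftarrow>bs. \<i> * complex_of_real (\<zeta> \<bullet> b)) * ?a \<zeta>"
      have db: "dlist bs (fseries ?a) = fseries ?b" "rapid ?b" using dlist_fseries[OF ra, of bs] by auto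
      have "norm (fseries ?b z) \<le> (\<Sum>\<^sub>\<infinity>\<zeta>\<in>lat. norm (?b \<zeta>))" by (rule norm_fseries_le[OF db(2)])
      also have "\<dots> \<le> (\<Sum>\<^sub>\<infinity>\<zeta>\<in>lat. if \<zeta> \<in> - F then g \<zeta> else 0)"
      proof (rule infsum_mono)
        show "(\<lambda>\<zeta>. norm (?b \<zeta>)) summable_on lat" by (rule rapid_norm_summable[OF db(2)])
        show "(\<lambda>\<zeta>. if \<zeta> \<in> - F then g \<zeta> else 0) summable_on lat" using g' by (simp add: has_sum_iff)
        fix \<zeta>
        have "norm (\<Prod>b\<leftarrow>bs. \<i> * complex_of_real (\<zeta> \<bullet> b)) \<le> (1 + norm \<zeta>) ^ k"
          using norm_prod_list_inner_le[OF bs(1), of \<zeta>] power_increasing[OF bs(2), of "1 + norm \<zeta>"] by simp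
        then show "norm (?b \<zeta>) \<le> (if \<zeta> \<in> - F then g \<zeta> else 0)"
          by (simp add: g_def norm_mult mult.commute mult_left_mono)
      qed
      also have "\<dots> = S - sum g F" by (rule infsumI[OF g'])
      finally show "norm (dlist bs (fseries ?a) z) \<le> S - sum g F + e" using db(1) e by simp
    qed
    ultimately show ?thesis by simp
  qed
  show ?thesis
    unfolding has_sum_def
  proof (rule tendstoI)
    fix e :: real assume e: "e > 0"
    \<comment> \<open>The tail of \<open>g\<close> and the slack contribute one \<open>d\<close>
      each, so the error is at most \<open>C * (2 * d)\<close>, which is two thirds of
      \<open>e\<close>.\<close>
    define d where "d = e / (3 * C)"
    have d: "d > 0" "C * (2 * d) < e" using e C(1) by (auto simp: d_def)
    have "\<forall>\<^sub>F F in finite_subsets_at_top lat. dist (sum g F) S < d"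
      using g d(1) unfolding has_sum_def by (rule tendstoD)
    moreover have "\<forall>\<^sub>F F in finite_subsets_at_top lat. finite F \<and> F \<subseteq> lat"
      by (intro eventually_finite_subsets_at_top_weakI) auto
    ultimately show "\<forall>\<^sub>F F in finite_subsets_at_top lat. dist (\<Sum>\<zeta>\<in>F. a \<zeta> * u (tchar \<zeta>)) (u (fseries a)) < e"
    proof eventually_elim
      case (elim F)
      have "dist (\<Sum>\<zeta>\<in>F. a \<zeta> * u (tchar \<zeta>)) (u (fseries a)) \<le> C * (S - sum g F + d)"
        using tail[of F d] elim d by (simp add: dist_norm norm_minus_commute)
      also have "\<dots> \<le> C * (2 * d)"
        using elim C(1) by (intro mult_left_mono) (auto simp: dist_real_def)
      finally show ?case using d(2) by simp
    qed
  qed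
qed

text \<open>The density is the Fourier series with the coefficients that \<open>u\<close>
  prescribes. Its pairing with \<phi> and the value of \<open>u\<close> on the expanded \<phi> are
  the same sum after reflecting the lattice.\<close>

lemma smooth_distr_if_rapid:
  fixes u :: "('a::euclidean_space \<Rightarrow> complex) \<Rightarrow> complex"
  assumes u: "distribution u" and r: "rapid (\<lambda>\<zeta>. u (tchar (-\<zeta>)))"
  shows "smooth_distr u"
proof -
  let ?V = "complex_of_real ((2*pi) ^ DIM('a))"
  let ?a = "\<lambda>\<zeta>. u (tchar (-\<zeta>)) / ?V"
  have ra: "rapid ?a"
    by (rule rapid_dominated[OF r, of _ "1 / (2*pi) ^ DIM('a)" 0]) (simp add: norm_divide norm_power norm_mult)
  show ?thesis
    unfolding smooth_distr_def
  proof (intro bexI ballI)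
    show "fseries ?a \<in> Cinf_torus" by (rule fseries_Cinf[OF ra])
    fix \<phi> :: "'a \<Rightarrow> complex" assume \<phi>: "\<phi> \<in> Cinf_torus"
    have "((\<lambda>\<zeta>. ?a \<zeta> * fcoef \<phi> (-\<zeta>)) has_sum fun_distr (fseries ?a) \<phi>) lat"
      by (intro fun_distr_fseries ra CinfD(2)[OF \<phi>])
    moreover have "((\<lambda>\<zeta>. fcoef \<phi> \<zeta> / ?V * u (tchar \<zeta>)) has_sum u \<phi>) lat"
      using distribution_fseries[OF u fourier_inversion(2)[OF \<phi>]]
      unfolding fourier_inversion(1)[OF \<phi>, symmetric] .
    then have "((\<lambda>\<zeta>. fcoef \<phi> (-\<zeta>) / ?V * u (tchar (-\<zeta>))) has_sum u \<phi>) lat"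
      using has_sum_reindex_bij_betw[OF bij_betw_uminus_lat, of "\<lambda>\<zeta>. fcoef \<phi> \<zeta> / ?V * u (tchar \<zeta>)"] by simp
    then have "((\<lambda>\<zeta>. ?a \<zeta> * fcoef \<phi> (-\<zeta>)) has_sum u \<phi>) lat"
      by (simp add: mult.commute)
    ultimately show "u \<phi> = fun_distr (fseries ?a) \<phi>" using has_sum_unique by blast
  qed
qed

section \<open>The symbol criterion for global hypoellipticity\<close>

text \<open>The symbol without \<open>lam\<close>. It is additive, and its values on the lattice
  form the group generated by 1 and the entries of \<alpha>.\<close>

definition symb :: "complex ^ 'n::finite \<Rightarrow> 'n pt \<Rightarrow> complex" where
  "symb \<alpha> \<zeta> = of_real (fst \<zeta>) + (\<Sum>j\<in>UNIV. \<alpha> $ j * of_real (snd \<zeta> $ j))"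

text \<open>Frequencies at which dividing by the symbol would cost more than
  \<open>(1 + norm \<zeta>) ^ m\<close>. The product form also covers those where
  \<open>symb \<alpha> \<zeta>\<close> equals \<open>lam\<close>.\<close>

definition near :: "complex ^ 'n::finite \<Rightarrow> complex \<Rightarrow> nat \<Rightarrow> 'n pt set" where
  "near \<alpha> lam m = {\<zeta> \<in> lat. norm (symb \<alpha> \<zeta> - lam) * (1 + norm \<zeta>) ^ m < 1}"

lemma Basis_pt: "(1, 0) \<in> (Basis :: 'n::finite pt set)" "(0, axis j 1) \<in> (Basis :: 'n pt set)"
  by (auto simp: Basis_prod_def axis_in_Basis_iff)

lemma inner_pt: "\<zeta> \<bullet> (1, 0) = fst \<zeta>" "\<zeta> \<bullet> (0, axis j 1) = snd \<zeta> $ j"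
  for \<zeta> :: "'n::finite pt"
  by (cases \<zeta>; simp add: inner_axis)+

text \<open>Two sign changes cancel in the derivatives: one from the transpose, one from the
  frequency \<open>-\<zeta>\<close>.\<close>

lemma P_transpose_tchar:
  "P_transpose \<alpha> lam (tchar (-\<zeta>)) = (\<lambda>z. (symb \<alpha> \<zeta> - lam) * tchar (-\<zeta>) z)"
proof
  fix z
  have "P_transpose \<alpha> lam (tchar (-\<zeta>)) z =
      of_real (fst \<zeta>) * tchar (-\<zeta>) z + (\<Sum>j\<in>UNIV. \<alpha> $ j * of_real (snd \<zeta> $ j)) * tchar (-\<zeta>) z - lam * tchar (-\<zeta>) z"
    unfolding P_transpose_def Dt_def Dx_def pd_tchar
    by (simp add: inner_pt sum_negf sum_distrib_right mult.assoc)
  then show "P_transpose \<alpha> lam (tchar (-\<zeta>)) z = (symb \<alpha> \<zeta> - lam) * tchar (-\<zeta>) z"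
    by (simp add: symb_def algebra_simps)
qed

lemma fcoef_has_integral:
  "continuous_on UNIV f \<Longrightarrow> ((\<lambda>z. f z * tchar (-\<zeta>) z) has_integral fcoef f \<zeta>) cube"
  unfolding fcoef_def
  by (intro integrable_integral integrable_continuous continuous_intros) (rule continuous_on_subset, auto)

text \<open>The operator is diagonal on the coefficients of every test function. The singular
  example needs this form, since its image under \<open>P_op\<close> is tested against arbitrary
  \<phi>.\<close>

lemma fcoef_P_transpose:
  assumes \<phi>: "\<phi> \<in> Cinf_torus" and \<zeta>: "\<zeta> \<in> lat"
  shows "fcoef (P_transpose \<alpha> lam \<phi>) (-\<zeta>) = (symb \<alpha> \<zeta> - lam) * fcoef \<phi> (-\<zeta>)"
proof -
  let ?f = "fcoef \<phi> (-\<zeta>)" and ?e = "tchar (- (-\<zeta>))"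
  have p: "((\<lambda>z. - \<i> * pd b \<phi> z * ?e z) has_integral (- (of_real (\<zeta> \<bullet> b) * ?f))) cube" if b: "b \<in> Basis" for b
  proof -
    have "((\<lambda>z. - \<i> * (pd b \<phi> z * ?e z)) has_integral (- \<i> * fcoef (pd b \<phi>) (-\<zeta>))) cube"
      by (intro has_integral_mult_right fcoef_has_integral CinfD(2)[OF pd_Cinf[OF \<phi> b]])
    moreover have "- \<i> * fcoef (pd b \<phi>) (-\<zeta>) = - (of_real (\<zeta> \<bullet> b) * ?f)"
      using \<zeta> by (simp add: fcoef_pd[OF \<phi> b] flip: mult.assoc)
    ultimately show ?thesis by (simp only: mult.assoc)
  qed
  have "((\<lambda>z. - (- \<i> * pd (1, 0) \<phi> z * ?e z) - (\<Sum>j\<in>UNIV. \<alpha> $ j * (- \<i> * pd (0, axis j 1) \<phi> z * ?e z)) - lam * (\<phi> z * ?e z))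
    has_integral (- (- (of_real (\<zeta> \<bullet> (1, 0)) * ?f)) - (\<Sum>j\<in>UNIV. \<alpha> $ j * (- (of_real (\<zeta> \<bullet> (0, axis j 1)) * ?f))) - lam * ?f)) cube"
    by (intro has_integral_diff has_integral_neg has_integral_sum has_integral_mult_right p Basis_pt
         fcoef_has_integral CinfD(2)[OF \<phi>] finite)
  moreover have "(\<lambda>z. - (- \<i> * pd (1, 0) \<phi> z * ?e z) - (\<Sum>j\<in>UNIV. \<alpha> $ j * (- \<i> * pd (0, axis j 1) \<phi> z * ?e z)) - lam * (\<phi> z * ?e z))
      = (\<lambda>z. P_transpose \<alpha> lam \<phi> z * ?e z)"
    by (simp add: fun_eq_iff P_transpose_def Dt_def Dx_def left_diff_distrib distrib_right sum_distrib_right mult.assoc)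
  moreover have "- (- (of_real (\<zeta> \<bullet> (1, 0)) * ?f)) - (\<Sum>j\<in>UNIV. \<alpha> $ j * (- (of_real (\<zeta> \<bullet> (0, axis j 1)) * ?f))) - lam * ?f
      = (symb \<alpha> \<zeta> - lam) * ?f"
    by (simp add: inner_pt symb_def left_diff_distrib distrib_right sum_distrib_right sum_negf mult.assoc)
  ultimately show ?thesis by (simp add: fcoef_def integral_unique)
qed

text \<open>The coefficients of \<open>u\<close> are split. Those in the finite set
  \<open>near \<alpha> lam m\<close> decay trivially; outside it, division by the symbol costs at
  most a power \<open>m\<close>, which the rapid coefficients of \<open>f\<close> absorb.\<close>

lemma globally_hypoelliptic_if_finite_near:
  fixes \<alpha> :: "complex ^ 'n::finite"
  assumes fin: "finite (near \<alpha> lam m)"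
  shows "globally_hypoelliptic \<alpha> lam"
  unfolding globally_hypoelliptic_def
proof (intro allI impI)
  fix u :: "('n pt \<Rightarrow> complex) \<Rightarrow> complex"
  assume u: "distribution u" and "smooth_distr (P_op \<alpha> lam u)"
  then obtain f where f: "f \<in> Cinf_torus" "\<And>\<phi>. \<phi> \<in> Cinf_torus \<Longrightarrow> u (P_transpose \<alpha> lam \<phi>) = fun_distr f \<phi>"
    unfolding smooth_distr_def P_op_def by blast
  have eq: "(symb \<alpha> \<zeta> - lam) * u (tchar (-\<zeta>)) = fcoef f \<zeta>" if "\<zeta> \<in> lat" for \<zeta>
  proof -
    have t: "tchar (-\<zeta>) \<in> Cinf_torus" using that by (simp add: tchar_Cinf)
    show ?thesis
      using f(2)[OF t] distribution_cmult[OF u t] by (simp add: P_transpose_tchar fcoef_eq_fun_distr)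
  qed
  let ?u = "\<lambda>\<zeta>. u (tchar (-\<zeta>))"
  have "rapid (\<lambda>\<zeta>. if \<zeta> \<in> near \<alpha> lam m then ?u \<zeta> else 0)"
    by (rule rapid_finite_support) (rule finite_subset[OF _ fin], auto)
  moreover have "rapid (\<lambda>\<zeta>. if \<zeta> \<in> near \<alpha> lam m then 0 else ?u \<zeta>)"
  proof (rule rapid_dominated[OF rapid_fcoef[OF f(1)], of _ 1 m])
    fix \<zeta> :: "'n pt" assume \<zeta>: "\<zeta> \<in> lat"
    show "norm (if \<zeta> \<in> near \<alpha> lam m then 0 else ?u \<zeta>) \<le> 1 * (1 + norm \<zeta>) ^ m * norm (fcoef f \<zeta>)"
    proof (cases "\<zeta> \<in> near \<alpha> lam m")
      case False
      then have "1 \<le> norm (symb \<alpha> \<zeta> - lam) * (1 + norm \<zeta>) ^ m" using \<zeta> by (simp add: near_def)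
      then have "1 * norm (?u \<zeta>) \<le> (norm (symb \<alpha> \<zeta> - lam) * (1 + norm \<zeta>) ^ m) * norm (?u \<zeta>)"
        by (rule mult_right_mono) simp
      also have "\<dots> = (1 + norm \<zeta>) ^ m * norm (fcoef f \<zeta>)"
        unfolding eq[OF \<zeta>, symmetric] norm_mult by simp
      finally show ?thesis using False by simp
    qed simp
  qed
  ultimately have "rapid (\<lambda>\<zeta>. (if \<zeta> \<in> near \<alpha> lam m then ?u \<zeta> else 0) + (if \<zeta> \<in> near \<alpha> lam m then 0 else ?u \<zeta>))"
    by (rule rapid_add)
  then have "rapid ?u" by (rule rapid_dominated[of _ _ 1 0]) auto
  with u show "smooth_distr u" by (rule smooth_distr_if_rapid)
qed

text \<open>Formally the sum of the characters in \<open>Z\<close>, so not smooth when \<open>Z\<close> is infinite.\<close>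
definition lacunary :: "'a::euclidean_space set \<Rightarrow> ('a \<Rightarrow> complex) \<Rightarrow> complex" where
  "lacunary Z \<phi> = (\<Sum>\<^sub>\<infinity>\<zeta>\<in>lat. if \<zeta> \<in> Z then fcoef \<phi> (-\<zeta>) else 0)"

lemma lacunary_has_sum:
  assumes "\<phi> \<in> Cinf_torus"
  shows "((\<lambda>\<zeta>. if \<zeta> \<in> Z then fcoef \<phi> (-\<zeta>) else 0) has_sum lacunary Z \<phi>) lat"
  unfolding lacunary_def
  by (rule has_sum_infsum[OF abs_summable_summable[OF rapid_norm_summable[OF
        rapid_restrict[OF rapid_uminus_arg[OF rapid_fcoef[OF assms]]]]]])

lemma lacunary_tchar:
  fixes Z :: "'a::euclidean_space set"
  assumes "Z \<subseteq> lat" "\<zeta> \<in> Z"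
  shows "lacunary Z (tchar (-\<zeta>)) = (2*pi) ^ DIM('a)"
proof -
  have \<zeta>: "\<zeta> \<in> lat" using assms by auto
  have "((\<lambda>\<eta>. if \<eta> \<in> Z then fcoef (tchar (-\<zeta>)) (-\<eta>) else 0) has_sum (complex_of_real ((2*pi) ^ DIM('a)))) lat"
  proof (rule has_sum_finite_neutralI[of "{\<zeta>}"])
    show "(if \<eta> \<in> Z then fcoef (tchar (-\<zeta>)) (-\<eta>) else 0) = 0" if "\<eta> \<in> lat - {\<zeta>}" for \<eta>
      using that \<zeta> by (auto simp: fcoef_tchar)
  qed (use assms \<zeta> in \<open>auto simp: fcoef_tchar\<close>)
  then show ?thesis unfolding lacunary_def by (simp add: infsumI)
qed

text \<open>Continuity rests on the explicit constant in \<open>fcoef_decay\<close>: control of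
  derivatives up to order \<open>2 * DIM('a)\<close> bounds all coefficients by one summable weight,
  whatever \<open>Z\<close> is.\<close>

lemma distribution_lacunary: "distribution (lacunary (Z :: 'a::euclidean_space set))"
  unfolding distribution_def
proof (intro conjI ballI allI)
  fix \<phi> \<psi> :: "'a \<Rightarrow> complex" assume \<phi>: "\<phi> \<in> Cinf_torus" and \<psi>: "\<psi> \<in> Cinf_torus"
  have "fcoef (\<lambda>z. \<phi> z + \<psi> z) \<zeta> = fcoef \<phi> \<zeta> + fcoef \<psi> \<zeta>" for \<zeta>
    unfolding fcoef_def[of "\<lambda>z. \<phi> z + \<psi> z"] distrib_right
    by (rule integral_unique) (intro has_integral_add fcoef_has_integral CinfD(2) \<phi> \<psi>)
  then have "(\<lambda>\<zeta>. (if \<zeta> \<in> Z then fcoef \<phi> (-\<zeta>) else 0) + (if \<zeta> \<in> Z then fcoef \<psi> (-\<zeta>) else 0))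
      = (\<lambda>\<zeta>. if \<zeta> \<in> Z then fcoef (\<lambda>z. \<phi> z + \<psi> z) (-\<zeta>) else 0)" by auto
  then show "lacunary Z (\<lambda>z. \<phi> z + \<psi> z) = lacunary Z \<phi> + lacunary Z \<psi>"
    using has_sum_add[OF lacunary_has_sum[OF \<phi>, of Z] lacunary_has_sum[OF \<psi>, of Z]]
    unfolding lacunary_def[of Z "\<lambda>z. \<phi> z + \<psi> z"] by (metis (no_types, lifting) infsumI)
next
  fix \<phi> :: "'a \<Rightarrow> complex" and c assume \<phi>: "\<phi> \<in> Cinf_torus"
  have "fcoef (\<lambda>z. c * \<phi> z) \<zeta> = c * fcoef \<phi> \<zeta>" for \<zeta>
    by (simp add: fcoef_def mult.assoc)
  then have "(\<lambda>\<zeta>. if \<zeta> \<in> Z then fcoef (\<lambda>z. c * \<phi> z) (-\<zeta>) else 0) = (\<lambda>\<zeta>. c * (if \<zeta> \<in> Z then fcoef \<phi> (-\<zeta>) else 0))"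
    by auto
  then show "lacunary Z (\<lambda>z. c * \<phi> z) = c * lacunary Z \<phi>"
    by (simp add: lacunary_def infsum_cmult_right' del: mult_if_delta)
next
  let ?m = "2 * DIM('a)"
  let ?D = "(1 + DIM('a)) ^ ?m * (1 * (2*pi) ^ DIM('a)) :: real"
  show "\<exists>C k. \<forall>\<phi>\<in>Cinf_torus. (\<forall>bs z. set bs \<subseteq> (Basis :: 'a set) \<and> length bs \<le> k \<longrightarrow> norm (dlist bs \<phi> z) \<le> 1)
          \<longrightarrow> norm (lacunary Z \<phi>) \<le> C"
  proof (intro exI ballI impI)
    fix \<phi> :: "'a \<Rightarrow> complex" assume \<phi>: "\<phi> \<in> Cinf_torus"
      and b: "\<forall>bs z. set bs \<subseteq> (Basis :: 'a set) \<and> length bs \<le> ?m \<longrightarrow> norm (dlist bs \<phi> z) \<le> 1"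
    show "norm (lacunary Z \<phi>) \<le> (\<Sum>\<^sub>\<infinity>\<zeta>\<in>(lat :: 'a set). ?D * (1 / (1 + norm \<zeta>) ^ ?m))"
    proof (rule norm_infsum_le[OF lacunary_has_sum[OF \<phi>]])
      show "((\<lambda>\<zeta>::'a. ?D * (1 / (1 + norm \<zeta>) ^ ?m)) has_sum (\<Sum>\<^sub>\<infinity>\<zeta>\<in>(lat :: 'a set). ?D * (1 / (1 + norm \<zeta>) ^ ?m))) lat"
        by (rule has_sum_infsum[OF summable_on_cmult_right[OF summable_on_lat]])
      fix \<zeta> :: 'a assume \<zeta>: "\<zeta> \<in> lat"
      have "norm (fcoef \<phi> (-\<zeta>)) * (1 + norm (-\<zeta>)) ^ ?m \<le> ?D"
        by (rule fcoef_decay[OF \<phi>]) (use b \<zeta> in auto)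
      then have "norm (fcoef \<phi> (-\<zeta>)) \<le> ?D * (1 / (1 + norm \<zeta>) ^ ?m)"
        by (simp add: pos_le_divide_eq add_pos_nonneg)
      then show "norm (if \<zeta> \<in> Z then fcoef \<phi> (-\<zeta>) else 0) \<le> ?D * (1 / (1 + norm \<zeta>) ^ ?m)"
        using norm_ge_zero[of "fcoef \<phi> (-\<zeta>)"] by (smt (verit, best) norm_zero)
    qed
  qed
qed

text \<open>A sequence \<open>z m\<close> in \<open>near \<alpha> lam m\<close> with growing norms
  supports the counterexample. The operator multiplies its constant coefficients by symbol values
  that decay faster than every power, so the image is smooth although the distribution is
  not.\<close>

lemma not_globally_hypoelliptic_if_infinite_near:
  fixes \<alpha> :: "complex ^ 'n::finite"
  assumes inf: "\<And>m. infinite (near \<alpha> lam m)"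
  shows "\<not> globally_hypoelliptic \<alpha> lam"
proof
  assume gh: "globally_hypoelliptic \<alpha> lam"
  have "\<exists>\<zeta>. \<zeta> \<in> near \<alpha> lam m \<and> norm \<zeta> > real m" for m
  proof (rule ccontr)
    assume "\<nexists>\<zeta>. \<zeta> \<in> near \<alpha> lam m \<and> norm \<zeta> > real m"
    then have "near \<alpha> lam m \<subseteq> {\<zeta> \<in> lat. norm \<zeta> \<le> real m}" by (force simp: near_def)
    then show False using inf finite_lat_norm_le finite_subset by blast
  qed
  then obtain z where z: "\<And>m. z m \<in> near \<alpha> lam m" "\<And>m. norm (z m) > real m" by metis
  have zlat: "range z \<subseteq> lat" using z(1) by (auto simp: near_def)
  define c where "c = (\<lambda>\<zeta>. if \<zeta> \<in> range z then symb \<alpha> \<zeta> - lam else 0)"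
  have rc: "rapid c"
    unfolding rapid_def
  proof
    fix M
    let ?g = "\<lambda>\<zeta>. norm (c \<zeta>) * (1 + norm \<zeta>) ^ M"
    \<comment> \<open>From index \<open>M\<close> on, membership of \<open>z m\<close> in
      \<open>near \<alpha> lam m\<close> bounds the term by 1. The finitely many earlier points are
      bounded by their sum.\<close>
    have "?g \<zeta> \<le> 1 + (\<Sum>m<M. ?g (z m))" for \<zeta>
    proof (cases "\<zeta> \<in> range z")
      case False then show ?thesis by (simp add: c_def sum_nonneg add_nonneg_nonneg)
    next
      case True
      then obtain m where m: "\<zeta> = z m" by auto
      show ?thesis
      proof (cases "m < M")
        case True
        then have "?g (z m) \<le> (\<Sum>m<M. ?g (z m))" by (intro member_le_sum) auto
        then show ?thesis using m by simp
      next
        case False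
        have "?g \<zeta> \<le> norm (symb \<alpha> \<zeta> - lam) * (1 + norm \<zeta>) ^ m"
          using False m by (auto simp: c_def intro!: mult_left_mono power_increasing)
        also have "\<dots> < 1" using z(1)[of m] m by (simp add: near_def)
        finally show ?thesis using sum_nonneg[of "{..<M}" "\<lambda>m. ?g (z m)"] by simp
      qed
    qed
    then show "\<exists>C. \<forall>\<zeta>\<in>lat. norm (c \<zeta>) * (1 + norm \<zeta>) ^ M \<le> C" by blast
  qed
  have "smooth_distr (P_op \<alpha> lam (lacunary (range z)))"
    unfolding smooth_distr_def P_op_def
  proof (intro bexI ballI)
    show "fseries c \<in> Cinf_torus" by (rule fseries_Cinf[OF rc])
    fix \<phi> :: "'n pt \<Rightarrow> complex" assume \<phi>: "\<phi> \<in> Cinf_torus"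
    have "((\<lambda>\<zeta>. c \<zeta> * fcoef \<phi> (-\<zeta>)) has_sum fun_distr (fseries c) \<phi>) lat"
      by (intro fun_distr_fseries rc CinfD(2)[OF \<phi>])
    moreover have "lacunary (range z) (P_transpose \<alpha> lam \<phi>) = (\<Sum>\<^sub>\<infinity>\<zeta>\<in>lat. c \<zeta> * fcoef \<phi> (-\<zeta>))"
      unfolding lacunary_def by (rule infsum_cong) (simp add: c_def fcoef_P_transpose[OF \<phi>])
    ultimately show "lacunary (range z) (P_transpose \<alpha> lam \<phi>) = fun_distr (fseries c) \<phi>"
      by (simp add: infsumI)
  qed
  with gh distribution_lacunary have "smooth_distr (lacunary (range z))"
    unfolding globally_hypoelliptic_def by blast
  then obtain f where f: "f \<in> Cinf_torus" "\<And>\<phi>. \<phi> \<in> Cinf_torus \<Longrightarrow> lacunary (range z) \<phi> = fun_distr f \<phi>"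
    unfolding smooth_distr_def by blast
  obtain C where C: "\<And>\<zeta>. \<zeta> \<in> lat \<Longrightarrow> norm (fcoef f \<zeta>) * (1 + norm \<zeta>) ^ 1 \<le> C"
    using rapid_fcoef[OF f(1)] unfolding rapid_def by metis
  let ?V = "(2*pi) ^ DIM('n pt)"
  \<comment> \<open>A smooth density would have coefficient \<open>?V\<close> at every
    \<open>z m\<close>; a single power of the unbounded norm already contradicts decay.\<close>
  have "?V * real m \<le> C" for m
  proof -
    have zm: "z m \<in> lat" using zlat by auto
    have "fcoef f (z m) = of_real ?V"
      using f(2)[of "tchar (- z m)"] zm lacunary_tchar[OF zlat, of "z m"]
      by (simp add: fcoef_eq_fun_distr tchar_Cinf)
    then have "?V * (1 + norm (z m)) \<le> C" using C[OF zm] by (simp add: norm_mult norm_power)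
    moreover have "?V * real m \<le> ?V * (1 + norm (z m))"
      using z(2)[of m] by (intro mult_left_mono) auto
    ultimately show ?thesis by linarith
  qed
  moreover obtain m where "C < ?V * real m"
    using reals_Archimedean3[of ?V] by (auto simp: mult.commute)
  ultimately show False by (meson not_less)
qed

section \<open>The exceptional set as a countable intersection of open sets\<close>

lemma M_set_iff: "lam \<in> M_set \<alpha> \<longleftrightarrow> (\<forall>m. infinite (near \<alpha> lam m))"
  using globally_hypoelliptic_if_finite_near not_globally_hypoelliptic_if_infinite_near
  unfolding M_set_def by blast

text \<open>A single index \<open>m\<close> suffices because \<open>near\<close> is decreasing in \<open>m\<close>.\<close>
lemma M_set_eq_Inter:
  "M_set \<alpha> = (\<Inter>m. \<Union>\<zeta>\<in>{\<zeta>\<in>lat. norm \<zeta> \<ge> real m}. ball (symb \<alpha> \<zeta>) (1 / (1 + norm \<zeta>) ^ m))"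
proof -
  have near: "\<zeta> \<in> near \<alpha> lam m \<longleftrightarrow> \<zeta> \<in> lat \<and> lam \<in> ball (symb \<alpha> \<zeta>) (1 / (1 + norm \<zeta>) ^ m)" for \<zeta> lam m
    by (simp add: near_def dist_norm pos_less_divide_eq add_pos_nonneg)
  have "(\<forall>m. infinite (near \<alpha> lam m)) \<longleftrightarrow> (\<forall>m. \<exists>\<zeta>\<in>near \<alpha> lam m. norm \<zeta> \<ge> real m)" for lam
  proof (intro iffI allI)
    fix m assume inf: "\<forall>m. infinite (near \<alpha> lam m)"
    show "\<exists>\<zeta>\<in>near \<alpha> lam m. norm \<zeta> \<ge> real m"
    proof (rule ccontr)
      assume "\<not> ?thesis"
      then have "near \<alpha> lam m \<subseteq> {\<zeta> \<in> lat. norm \<zeta> \<le> real m}" by (force simp: near_def)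
      then show False using inf finite_lat_norm_le finite_subset by blast
    qed
  next
    fix m assume *: "\<forall>m. \<exists>\<zeta>\<in>near \<alpha> lam m. norm \<zeta> \<ge> real m"
    show "infinite (near \<alpha> lam m)"
    proof
      assume fin: "finite (near \<alpha> lam m)"
      \<comment> \<open>\<open>R\<close> exceeds the norm of every element of the supposedly finite
        set, while an element of index at least \<open>R\<close> has norm at least \<open>R\<close>
        and belongs to that set.\<close>
      define R where "R = nat \<lceil>\<Sum>\<zeta>\<in>near \<alpha> lam m. norm \<zeta>\<rceil> + 1"
      obtain \<zeta> where \<zeta>: "\<zeta> \<in> near \<alpha> lam (max m R)" "norm \<zeta> \<ge> real (max m R)" using * by blast
      have "norm (symb \<alpha> \<zeta> - lam) * (1 + norm \<zeta>) ^ m \<le> norm (symb \<alpha> \<zeta> - lam) * (1 + norm \<zeta>) ^ max m R"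
        by (intro mult_left_mono power_increasing) auto
      then have "\<zeta> \<in> near \<alpha> lam m" using \<zeta>(1) by (simp add: near_def)
      then have "norm \<zeta> \<le> (\<Sum>\<zeta>\<in>near \<alpha> lam m. norm \<zeta>)" using fin by (intro member_le_sum) auto
      then show False using \<zeta>(2) unfolding R_def by linarith
    qed
  qed
  moreover have "(\<exists>\<zeta>\<in>near \<alpha> lam m. norm \<zeta> \<ge> real m) \<longleftrightarrow>
      lam \<in> (\<Union>\<zeta>\<in>{\<zeta>\<in>lat. norm \<zeta> \<ge> real m}. ball (symb \<alpha> \<zeta>) (1 / (1 + norm \<zeta>) ^ m))" for lam m
    using near by blast
  ultimately show ?thesis
    by (simp only: set_eq_iff M_set_iff INT_iff UNIV_I ball_UNIV simp_thms)
qed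

section \<open>Density of the values of the symbol\<close>

lemma gdelta_in_M_set: "gdelta_in euclidean (M_set \<alpha>)"
  unfolding M_set_eq_Inter
  by (rule gdelta_in_Inter) (auto intro!: open_imp_gdelta_in)

text \<open>One direction is elementary: a point of \<open>M_set\<close> lies within
  \<open>1 / m\<close> of a symbol value for every positive \<open>m\<close>. The converse hinges on
  density surviving the removal of finitely many centres.\<close>

lemma closure_M_set_iff:
  "closure (M_set \<alpha>) = UNIV \<longleftrightarrow> closure (symb \<alpha> ` lat) = UNIV"
proof
  assume M: "closure (M_set \<alpha>) = UNIV"
  have "x \<in> closure (symb \<alpha> ` lat)" for x
    unfolding closure_approachable
  proof (intro allI impI)
    fix e :: real assume e: "e > 0"
    have "x \<in> closure (M_set \<alpha>)" using M by simp
    then obtain lam where lam: "lam \<in> M_set \<alpha>" "dist lam x < e / 2"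
      unfolding closure_approachable using half_gt_zero[OF e] by blast
    obtain m where m: "m \<noteq> 0" "inverse (real m) < e / 2"
      using real_arch_inverse[of "e / 2"] e by auto
    obtain \<zeta> where \<zeta>: "\<zeta> \<in> lat" "norm \<zeta> \<ge> real m" "dist (symb \<alpha> \<zeta>) lam < 1 / (1 + norm \<zeta>) ^ m"
    proof -
      have "lam \<in> (\<Union>\<zeta>\<in>{\<zeta>\<in>lat. norm \<zeta> \<ge> real m}. ball (symb \<alpha> \<zeta>) (1 / (1 + norm \<zeta>) ^ m))"
        using lam(1) unfolding M_set_eq_Inter by blast
      then show ?thesis using that by (auto simp del: split_paired_Ex)
    qed
    have "real m \<le> (1 + norm \<zeta>) ^ 1" using \<zeta>(2) by simp
    also have "\<dots> \<le> (1 + norm \<zeta>) ^ m" using m(1) by (intro power_increasing) auto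
    finally have "1 / (1 + norm \<zeta>) ^ m \<le> 1 / real m" using m(1) by (intro divide_left_mono) auto
    then have "dist (symb \<alpha> \<zeta>) lam < e / 2" using \<zeta>(3) m(2) by (simp add: inverse_eq_divide)
    then have "dist (symb \<alpha> \<zeta>) x < e"
      using lam(2) dist_triangle[of "symb \<alpha> \<zeta>" x lam] by linarith
    then show "\<exists>y\<in>symb \<alpha> ` lat. dist y x < e" using \<zeta>(1) by blast
  qed
  then show "closure (symb \<alpha> ` lat) = UNIV" by auto
next
  assume dense: "closure (symb \<alpha> ` lat) = UNIV"
  let ?U = "\<lambda>m. \<Union>\<zeta>\<in>{\<zeta>\<in>lat. norm \<zeta> \<ge> real m}. ball (symb \<alpha> \<zeta>) (1 / (1 + norm \<zeta>) ^ m)"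
  have "UNIV \<subseteq> closure (\<Inter> (range ?U))"
  proof (rule Baire)
    fix T assume "T \<in> range ?U"
    then obtain m where T: "T = ?U m" by auto
    have "x \<in> closure T" for x
      unfolding closure_iff_nhds_not_empty
    proof (intro allI impI)
      fix A V :: "complex set" assume V: "V \<subseteq> A" "open V" "x \<in> V"
      \<comment> \<open>Values attained at the finitely many small frequencies are cut out of
        \<open>V\<close>. A nonempty open set in the plane is infinite, so a nonempty open set
        remains, and a symbol value in it can only come from a large frequency.\<close>
      define F where "F = symb \<alpha> ` {\<zeta> \<in> lat. norm \<zeta> \<le> real m}"
      have F: "finite F" unfolding F_def by (intro finite_imageI finite_lat_norm_le)
      have "infinite V" using V finite_imp_not_open[of V] by auto
      then obtain y where "y \<in> V - F" using F by (metis Diff_eq_empty_iff all_not_in_conv finite_subset)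
      moreover have "open (V - F)" using V F by (intro open_Diff finite_imp_closed)
      ultimately have "symb \<alpha> ` lat \<inter> (V - F) \<noteq> {}"
        using dense open_Int_closure_eq_empty[of "V - F" "symb \<alpha> ` lat"] by auto
      then obtain \<zeta> where \<zeta>: "\<zeta> \<in> lat" "symb \<alpha> \<zeta> \<in> V" "symb \<alpha> \<zeta> \<notin> F" by auto
      then have "norm \<zeta> \<ge> real m" unfolding F_def by force
      then have "symb \<alpha> \<zeta> \<in> T" unfolding T using \<zeta>(1)
        by (intro UN_I[of \<zeta>]) (auto intro: add_pos_nonneg)
      then show "T \<inter> A \<noteq> {}" using V(1) \<zeta>(2) by blast
    qed
    moreover have "open T" unfolding T by (intro open_UN ballI open_ball)
    ultimately show "openin (top_of_set UNIV) T \<and> UNIV \<subseteq> closure T" by auto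
  qed auto
  then show "closure (M_set \<alpha>) = UNIV" unfolding M_set_eq_Inter by auto
qed

section \<open>The group of symbol values and its density in the plane\<close>

lemma symb_add: "symb \<alpha> (\<zeta> + \<eta>) = symb \<alpha> \<zeta> + symb \<alpha> \<eta>"
  by (simp add: symb_def distrib_left sum.distrib)

lemma symb_uminus: "symb \<alpha> (- \<zeta>) = - symb \<alpha> \<zeta>"
  by (simp add: symb_def sum_negf)

text \<open>Translation by a group element permutes the group, so the set of distances is
  unchanged.\<close>

lemma infdist_add_symb:
  assumes "g \<in> symb \<alpha> ` lat"
  shows "infdist (z + g) (symb \<alpha> ` lat) = infdist z (symb \<alpha> ` lat)"
proof -
  obtain \<eta> where \<eta>: "\<eta> \<in> lat" "g = symb \<alpha> \<eta>" using assms by auto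
  have "(\<lambda>a. dist (z + g) a) ` symb \<alpha> ` lat = (\<lambda>a. dist z a) ` symb \<alpha> ` lat"
  proof (intro equalityI image_subsetI)
    fix a assume "a \<in> symb \<alpha> ` lat"
    then obtain \<zeta> where \<zeta>: "\<zeta> \<in> lat" "a = symb \<alpha> \<zeta>" by auto
    have "dist (z + g) a = dist z (symb \<alpha> (\<zeta> + - \<eta>))" "dist z a = dist (z + g) (symb \<alpha> (\<zeta> + \<eta>))"
      unfolding symb_add symb_uminus using \<zeta> \<eta> by (simp_all add: dist_norm algebra_simps)
    moreover have "\<zeta> + - \<eta> \<in> lat" "\<zeta> + \<eta> \<in> lat" by (rule lat_add[OF \<zeta>(1) lat_uminus[OF \<eta>(1)]]) (rule lat_add[OF \<zeta>(1) \<eta>(1)])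
    ultimately show "dist (z + g) a \<in> (\<lambda>a. dist z a) ` symb \<alpha> ` lat"
      "dist z a \<in> (\<lambda>a. dist (z + g) a) ` symb \<alpha> ` lat" by blast+
  qed
  moreover have "symb \<alpha> ` lat \<noteq> {}" using lat_zero by blast
  ultimately show ?thesis by (simp add: infdist_notempty)
qed

lemma cis_eq_1_imp_Ints:
  assumes "cis (2 * pi * x) = 1" shows "x \<in> \<int>"
proof -
  have "cos (2 * pi * x) = 1" using assms by (simp add: complex_eq_iff)
  then obtain n :: int where "2 * pi * x = of_int n * 2 * pi"
    using cos_one_2pi_int by auto
  then have "x = of_int n" by simp
  then show ?thesis by simp
qed

text \<open>The distance to the subgroup, in coordinates making it periodic, is a continuous function on
  the two-torus that is invariant under translation by every \<open>\<alpha>\<^sub>j\<close>; the hypothesis forces all its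
  nonconstant Fourier modes to vanish.\<close>
lemma closure_symb_eq_UNIV:
  fixes \<alpha> :: "complex ^ 'n::finite"
  assumes k: "Im (\<alpha> $ k) \<noteq> 0"
    and xy: "\<And>j. \<alpha> $ j = of_real (x j) + of_real (y j) * \<alpha> $ k"
    and ind: "\<And>m n. m \<in> \<int> \<Longrightarrow> n \<in> \<int> \<Longrightarrow> (\<And>j. m * x j + n * y j \<in> \<int>) \<Longrightarrow> m = 0 \<and> n = 0"
  shows "closure (symb \<alpha> ` lat) = UNIV"
proof -
  let ?G = "symb \<alpha> ` lat"
  \<comment> \<open>\<open>T\<close> reads coordinates, in units of \<open>2 * pi\<close>, in the
    real basis 1, \<open>\<alpha> $ k\<close>. A full period along either axis becomes translation
    by an element of \<open>?G\<close>, which makes \<open>h\<close> periodic.\<close>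
  define T where "T = (\<lambda>p :: real \<times> real. (of_real (fst p) + of_real (snd p) * \<alpha> $ k) / (2 * pi))"
  define h where "h = (\<lambda>p. complex_of_real (infdist (T p) ?G))"
  have T_add: "T (p + w) = T p + T w" for p w by (simp add: T_def field_simps)
  have one: "1 \<in> ?G"
  proof
    show "1 = symb \<alpha> (1, 0)" by (simp add: symb_def)
    show "(1, 0) \<in> (lat :: 'n pt set)" by (intro lat_Basis Basis_pt)
  qed
  have alpha: "\<alpha> $ j \<in> ?G" for j
  proof
    have "(\<Sum>i\<in>UNIV. \<alpha> $ i * complex_of_real (axis j 1 $ i)) = (\<Sum>i\<in>UNIV. if i = j then \<alpha> $ i else 0)"
      by (intro sum.cong) (auto simp: axis_def)
    then show "\<alpha> $ j = symb \<alpha> (0, axis j 1)" by (simp add: symb_def)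
    show "(0, axis j 1) \<in> (lat :: 'n pt set)" by (intro lat_Basis Basis_pt)
  qed
  have h_shift: "h (p + w) = h p" if "T w \<in> ?G" for p w
    using infdist_add_symb[OF that] by (simp add: h_def T_add)
  have per: "periodic_fun h"
    unfolding periodic_fun_def
  proof (intro allI ballI h_shift)
    fix b :: "real \<times> real" assume "b \<in> Basis"
    then have "b = (1, 0) \<or> b = (0, 1)" by (auto simp: Basis_prod_def)
    then show "T ((2 * pi) *\<^sub>R b) \<in> ?G" using one alpha[of k] by (auto simp: T_def)
  qed
  have cont: "continuous_on S h" for S
    unfolding h_def T_def by (intro continuous_intros) auto
  have coef: "fcoef h \<zeta> = 0" if \<zeta>: "\<zeta> \<in> lat" "\<zeta> \<noteq> 0" for \<zeta>
  proof (rule ccontr)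
    assume nz: "fcoef h \<zeta> \<noteq> 0"
    have int: "fst \<zeta> * x j + snd \<zeta> * y j \<in> \<int>" for j
    proof -
      \<comment> \<open>Chosen so that \<open>T w = \<alpha> $ j\<close>. Translation by
        \<open>w\<close> fixes \<open>h\<close> but multiplies its coefficient at \<zeta> by
        \<open>tchar (-\<zeta>) w\<close>, so a nonzero coefficient forces that factor to be
        1.\<close>
      define w where "w = (2 * pi) *\<^sub>R (x j, y j)"
      have "T w = \<alpha> $ j" unfolding xy[of j] by (simp add: T_def w_def field_simps)
      then have hw: "h (p + w) = h p" for p using h_shift alpha by simp
      let ?f = "\<lambda>p. h p * tchar (-\<zeta>) p"
      have "periodic_fun ?f"
        using per periodic_tchar[of "-\<zeta>"] \<zeta>(1) by (simp add: periodic_fun_def)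
      then have "integral cube (\<lambda>p. ?f (p + w)) = integral cube ?f"
        by (intro integral_cube_shift continuous_intros cont)
      moreover have "(\<lambda>p. ?f (p + w)) = (\<lambda>p. ?f p * tchar (-\<zeta>) w)"
        by (simp add: hw tchar_add_right mult.assoc)
      ultimately have "fcoef h \<zeta> * tchar (-\<zeta>) w = fcoef h \<zeta>"
        by (simp add: fcoef_def)
      then have "tchar (-\<zeta>) w = 1" using nz by simp
      moreover have "(-\<zeta>) \<bullet> w = 2 * pi * - (fst \<zeta> * x j + snd \<zeta> * y j)"
        by (cases \<zeta>) (simp add: w_def algebra_simps)
      ultimately have "- (fst \<zeta> * x j + snd \<zeta> * y j) \<in> \<int>"
        unfolding tchar_def by (metis cis_eq_1_imp_Ints)
      then show ?thesis by (metis Ints_minus minus_minus)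
    qed
    have "(1, 0) \<in> (Basis :: (real \<times> real) set)" "(0, 1) \<in> (Basis :: (real \<times> real) set)"
      by (auto simp: Basis_prod_def)
    then have "\<zeta> \<bullet> (1, 0) \<in> \<int>" "\<zeta> \<bullet> (0, 1) \<in> \<int>" using \<zeta>(1) unfolding lat_def by blast+
    then have "fst \<zeta> \<in> \<int>" "snd \<zeta> \<in> \<int>" by (simp_all add: inner_prod_def)
    then have "fst \<zeta> = 0 \<and> snd \<zeta> = 0" using int by (rule ind)
    then show False using \<zeta>(2) by (simp add: prod_eq_iff)
  qed
  \<comment> \<open>The mean of \<open>h\<close>: subtracting it removes the only Fourier mode that
    may survive.\<close>
  define c where "c = fcoef h 0 / (2*pi) ^ DIM(real \<times> real)"
  have hc: "h p - c = 0" for p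
  proof (rule fcoef_eq_0_imp_eq_0[where h = "\<lambda>p. h p - c"])
    show "continuous_on UNIV (\<lambda>p. h p - c)" by (intro continuous_intros cont)
    show "periodic_fun (\<lambda>p. h p - c)" using per by (simp add: periodic_fun_def)
    fix \<zeta> :: "real \<times> real" assume \<zeta>: "\<zeta> \<in> lat"
    have "fcoef (\<lambda>p. c) \<zeta> = c * fcoef (tchar 0) \<zeta>" by (simp add: fcoef_def)
    then have "fcoef (\<lambda>p. h p - c) \<zeta> = fcoef h \<zeta> - c * fcoef (tchar 0) \<zeta>"
      using fcoef_diff[of h "\<lambda>_. c" \<zeta>] cont by simp
    then show "fcoef (\<lambda>p. h p - c) \<zeta> = 0"
      using fcoef_tchar[OF lat_zero \<zeta>] coef[OF \<zeta>] by (auto simp: c_def)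
  qed
  \<comment> \<open>The constant value of \<open>h\<close> is read off at 0, which belongs to the
    group.\<close>
  have "0 \<in> ?G" using lat_zero by (force simp: symb_def)
  then have "h 0 = 0" by (simp add: h_def T_def)
  then have inf0: "infdist (T p) ?G = 0" for p using hc[of p] hc[of 0] by (simp add: h_def)
  have "z \<in> closure ?G" for z
  proof -
    \<comment> \<open>The solution of \<open>T p = z\<close>: the imaginary part determines the
      second coordinate, and the real part then the first.\<close>
    define p where "p = (2 * pi * (Re z - Im z / Im (\<alpha> $ k) * Re (\<alpha> $ k)), 2 * pi * (Im z / Im (\<alpha> $ k)))"
    have "T p = z" unfolding T_def p_def using k by (simp add: complex_eq_iff field_simps)
    then show ?thesis using inf0[of p] \<open>0 \<in> ?G\<close> in_closure_iff_infdist_zero[of ?G z] by auto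
  qed
  then show ?thesis by auto
qed

text \<open>A nonzero real linear functional with integer values on the group confines its closure
  to the closed preimage of the integers, which is not the whole plane. Integrality of
  \<open>n\<close> is the instance \<open>j = k\<close> of the second part of \<open>mn\<close>,
  where the coordinates are 0 and 1.\<close>

lemma closure_symb_neq_UNIV:
  fixes \<alpha> :: "complex ^ 'n::finite"
  assumes k: "Im (\<alpha> $ k) \<noteq> 0"
    and xy: "\<And>j. \<alpha> $ j = of_real (x j) + of_real (y j) * \<alpha> $ k"
    and mn: "m \<in> \<int>" "\<And>j. m * x j + n * y j \<in> \<int>" "(m, n) \<noteq> (0, 0)"
  shows "closure (symb \<alpha> ` lat) \<noteq> UNIV"
proof
  assume dense: "closure (symb \<alpha> ` lat) = UNIV"
  \<comment> \<open>The real linear functional with value \<open>m\<close> at 1 and \<open>n\<close>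
    at \<open>\<alpha> $ k\<close>.\<close>
  define F where "F = (\<lambda>z. m * (Re z - Im z / Im (\<alpha> $ k) * Re (\<alpha> $ k)) + n * (Im z / Im (\<alpha> $ k)))"
  have lin: "linear F"
    by (rule linearI) (simp_all add: F_def add_divide_distrib algebra_simps)
  have Fp: "F (of_real a + of_real b * \<alpha> $ k) = m * a + n * b" for a b
    using k by (simp add: F_def)
  have "F z \<in> \<int>" if z: "z \<in> symb \<alpha> ` lat" for z
  proof -
    obtain \<zeta> where \<zeta>: "\<zeta> \<in> lat" "z = symb \<alpha> \<zeta>" using z by auto
    have int: "fst \<zeta> \<in> \<int>" "snd \<zeta> $ j \<in> \<int>" for j
      using \<zeta>(1) Basis_pt(1)[where ?'n = 'n] Basis_pt(2)[of j] unfolding lat_def by (metis (mono_tags, lifting) inner_pt mem_Collect_eq)+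
    have Fj: "F (\<alpha> $ j * of_real r) = r * (m * x j + n * y j)" for j r
    proof -
      have "F (r *\<^sub>R \<alpha> $ j) = r * F (\<alpha> $ j)" using linear_cmul[OF lin] by simp
      also have "F (\<alpha> $ j) = m * x j + n * y j" by (subst xy) (rule Fp)
      finally show ?thesis by (simp add: scaleR_conv_of_real mult.commute)
    qed
    have "F z = F (of_real (fst \<zeta>)) + (\<Sum>j\<in>UNIV. F (\<alpha> $ j * of_real (snd \<zeta> $ j)))"
      unfolding \<zeta>(2) symb_def by (simp only: linear_add[OF lin] linear_sum[OF lin])
    also have "F (of_real (fst \<zeta>)) = m * fst \<zeta>" using Fp[of "fst \<zeta>" 0] by simp
    finally have "F z = m * fst \<zeta> + (\<Sum>j\<in>UNIV. snd \<zeta> $ j * (m * x j + n * y j))" by (simp only: Fj)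
    then show ?thesis using int mn by (simp add: Ints_add Ints_mult Ints_sum)
  qed
  then have "symb \<alpha> ` lat \<subseteq> F -` \<int>" by auto
  moreover have "closed (F -` \<int>)"
    by (intro closed_vimage closed_Ints linear_continuous_on linear_conv_bounded_linear[THEN iffD1] lin)
  ultimately have "closure (symb \<alpha> ` lat) \<subseteq> F -` \<int>" by (rule closure_minimal)
  then have FI: "F z \<in> \<int>" for z using dense by auto
  have half: "(1/2 :: real) \<notin> \<int>"
  proof
    assume "(1/2 :: real) \<in> \<int>"
    then obtain i where "1/2 = real_of_int i" by (rule Ints_cases)
    then have "real_of_int (2 * i) = of_int 1" by simp
    then have "2 * i = 1" by (simp only: of_int_eq_iff)
    then show False by presburger
  qed
  \<comment> \<open>Whichever of \<open>m\<close> and \<open>n\<close> is nonzero, a real multiple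
    of the matching basis vector is sent to 1/2.\<close>
  show False
  proof (cases "m = 0")
    case False
    then show False using FI[of "of_real (1 / (2 * m)) + of_real 0 * \<alpha> $ k"] half unfolding Fp by simp
  next
    case True
    then show False using FI[of "of_real 0 + of_real (1 / (2 * n)) * \<alpha> $ k"] half mn(3) unfolding Fp by simp
  qed
qed

text \<open>This turns a rational relation into an integral one. The multiplier \<open>q\<close> is
  itself kept integral so that, in the induction step, \<open>q\<close> times the new numerator is
  an integer.\<close>

lemma common_denominator:
  assumes "finite S" "S \<subseteq> (\<rat> :: real set)"
  shows "\<exists>q::real. q \<in> \<int> \<and> q \<noteq> 0 \<and> (\<forall>x\<in>S. q * x \<in> \<int>)"
  using assms
proof (induction S rule: finite_induct)
  case empty
  show ?case by (intro exI[of _ 1]) auto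
next
  case (insert x S)
  then obtain q :: real where q: "q \<in> \<int>" "q \<noteq> 0" "\<forall>x\<in>S. q * x \<in> \<int>" by auto
  obtain a b where ab: "b > 0" "x = of_int a / of_int b"
    using insert.prems by (auto elim: Rats_cases')
  show ?case
  proof (intro exI[of _ "of_int b * q"] conjI ballI)
    fix y assume y: "y \<in> insert x S"
    show "of_int b * q * y \<in> \<int>"
    proof (cases "y = x")
      case True
      then have "of_int b * q * y = q * of_int a" using ab by simp
      then show ?thesis using q(1) by (simp only: Ints_mult Ints_of_int)
    next
      case False
      then have "q * y \<in> \<int>" using y q(3) by auto
      then have "of_int b * (q * y) \<in> \<int>" by (rule Ints_mult[OF Ints_of_int])
      then show ?thesis by (simp only: mult.assoc)
    qed
  qed (use q ab in auto)
qed

theorem theorem2p6: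
  fixes \<alpha> :: "complex ^ 'n::finite" and k :: 'n
  assumes "CARD('n) \<ge> 2"
    and "Im (\<alpha> $ k) \<noteq> 0"
  shows "(closure (M_set \<alpha>) = UNIV \<and> gdelta_in euclidean (M_set \<alpha>)) \<longleftrightarrow>
         {r :: real \<times> real. fst r \<in> \<rat> \<and> snd r \<in> \<rat> \<and>
            (\<forall>j. j \<noteq> k \<longrightarrow> (a1 \<alpha> k j * fst r + a2 \<alpha> k j * snd r) / Im (\<alpha> $ k) \<in> \<rat>)}
         = {(0, 0)}"
proof -
  define x where "x = (\<lambda>j. a1 \<alpha> k j / Im (\<alpha> $ k))"
  define y where "y = (\<lambda>j. a2 \<alpha> k j / Im (\<alpha> $ k))"
  have xy: "\<alpha> $ j = of_real (x j) + of_real (y j) * \<alpha> $ k" for j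
    using assms(2) by (simp add: complex_eq_iff x_def y_def a1_def a2_def field_simps)
  \<comment> \<open>The index \<open>k\<close>, omitted from A, would contribute the value
    \<open>snd r\<close>, which is rational already; integral relations over all indices therefore
    match the condition over \<open>j \<noteq> k\<close>.\<close>
  have xk: "x k = 0" "y k = 1" using assms(2) by (simp_all add: x_def y_def a1_def a2_def)
  have val: "(a1 \<alpha> k j * a + a2 \<alpha> k j * b) / Im (\<alpha> $ k) = a * x j + b * y j" for a b j
    by (simp add: x_def y_def add_divide_distrib mult.commute)
  let ?R = "{r :: real \<times> real. fst r \<in> \<rat> \<and> snd r \<in> \<rat> \<and> (\<forall>j. j \<noteq> k \<longrightarrow> fst r * x j + snd r * y j \<in> \<rat>)}"
  have "closure (symb \<alpha> ` lat) = UNIV \<longleftrightarrow> ?R = {(0, 0)}"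
  proof
    assume R: "?R = {(0, 0)}"
    show "closure (symb \<alpha> ` lat) = UNIV"
    proof (rule closure_symb_eq_UNIV[OF assms(2) xy])
      fix m n :: real assume "m \<in> \<int>" "n \<in> \<int>" "\<And>j. m * x j + n * y j \<in> \<int>"
      then have "(m, n) \<in> ?R" using Ints_subset_Rats by auto
      then show "m = 0 \<and> n = 0" unfolding R by simp
    qed
  next
    assume dense: "closure (symb \<alpha> ` lat) = UNIV"
    have "r = (0, 0)" if r: "r \<in> ?R" for r
    proof (rule ccontr)
      assume nz: "r \<noteq> (0, 0)"
      \<comment> \<open>Both entries of \<open>r\<close> are included because they must become
        integers as well; \<open>snd r\<close> also supplies the value at the index
        \<open>k\<close>.\<close>
      let ?S = "insert (fst r) (insert (snd r) ((\<lambda>j. fst r * x j + snd r * y j) ` (UNIV - {k})))"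
      have "finite ?S" "?S \<subseteq> \<rat>" using r by auto
      then obtain q :: real where q: "q \<in> \<int>" "q \<noteq> 0" "\<forall>s\<in>?S. q * s \<in> \<int>"
        using common_denominator by blast
      have "closure (symb \<alpha> ` lat) \<noteq> UNIV"
      proof (rule closure_symb_neq_UNIV[OF assms(2) xy])
        show "q * fst r \<in> \<int>" using q by blast
        show "(q * fst r, q * snd r) \<noteq> (0, 0)" using q nz by (auto simp: prod_eq_iff)
        show "q * fst r * x j + q * snd r * y j \<in> \<int>" for j
        proof (cases "j = k")
          case True
          then show ?thesis using q(3) by (simp add: xk)
        next
          case False
          then have "q * (fst r * x j + snd r * y j) \<in> \<int>" using q(3) by blast
          then show ?thesis by (simp add: algebra_simps)
        qed
      qed
      then show False using dense by simp
    qed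
    moreover have "(0, 0) \<in> ?R" by simp
    ultimately show "?R = {(0, 0)}" by blast
  qed
  then show ?thesis
    unfolding val closure_M_set_iff by (simp add: gdelta_in_M_set)
qed

end
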